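(* Let $X$ be a Euclidean polyhedral space, $U\subset X$ open, and $\Pi$ a polyhedral complex on $X$ such that $\Pi|_U$ is finite. Then there is a subdivision $\Pi'$ of $\Pi$ such that for every piecewise affine function $g$ on $U$ defined on $\Pi'$ there are concave piecewise affine functions $f_1,f_2$ on $U$ defined on $\Pi'$ with $g=f_1-f_2$.
   Context: Polyhedral spaces. Let $X$ be a second countable topological space. A polyhedral structure $\Pi$ on $X$ is a locally finite covering of $X$ by distinct closed subsets $\sigma$ (polyhedra), each with a finite-dimensional vector space $M_\sigma$ of continuous real functions on $\sigma$ such that, with $N_\sigma=\operatorname{Hom}(M_\sigma,\mathbb{R})$, the evaluation map $\phi_\sigma\colon\sigma\to N_\sigma$ is a homeomorphism onto a full-dimensional convex polyhedron of an affine hyperplane of $N_\sigma$ not containing $0$. Faces of $\sigma$ are preimages of faces of $\phi_\sigma(\sigma)$ (including the empty face); every face of a polyhedron is a polyhedron of $\Pi$ with function space the restrictions of $M_\sigma$; any two polyhedra meet in a common face. Each polyhedron has an affine structure, dimension, facets. $\Pi'$ subdivides $\Pi$ if each polyhedron of $\Pi'$ lies in one of $\Pi$ with affine inclusion; structures are equivalent if they have a common subdivision. A polyhedral space is $X$ with an equivalence class of structures; a polyhedral complex on $X$ is a member. $\tau\prec\sigma$ means $\tau$ is a face of $\sigma$. A Euclidean polyhedral space is a polyhedral space $X$ with a finite-dimensional Euclidean vector space $N_X$ and a map $\iota\colon X\to N_X$ with image in an affine hyperplane $H_X\not\ni0$ such that some polyhedral complex has $\iota$ injective and affine on each polyhedron;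 only such complexes are considered. For a nonempty facet $\tau$ of $\sigma$, $v_{\sigma\setminus\tau}$ is the unit vector orthogonal to the affine span of $\iota(\tau)$, parallel to that of $\iota(\sigma)$, pointing towards $\iota(\sigma)$. For $V$ open, $\Pi|_V$ is the set of polyhedra meeting $V$, $\Pi|_V(k)$ those of dimension $k$. A $k$-dimensional weight $c\colon\Pi|_V(k)\to\mathbb{R}$ is positive if $c\ge0$, a Minkowski weight if $\sum_{\sigma\in\Pi|_V(k),\sigma\succ\tau}c(\sigma)v_{\sigma\setminus\tau}=0$ for every $\tau\in\Pi|_V(k-1)$. A piecewise affine function on $V$ defined on $\Pi$ is $f\colon V\to\mathbb{R}$ affine on each $\sigma\cap V$, $\sigma\in\Pi|_V$; write $f=f_\sigma\circ\iota$ there with $f_\sigma$ linear; $(f\cdot c)(\tau)=-\sum_{\sigma\succ\tau}c(\sigma)f_\sigma(v_{\sigma\setminus\tau})$. Minkowski cycles are Minkowski weights modulo pullback to subdivisions ($c_{\Pi'}(\sigma')=c(\sigma)$ if $\sigma'\subset\sigma$ with the same dimension, else $0$); positive if represented by a positive Minkowski weight; $f\cdot[c]=[f\cdot c]$. A piecewise affine $f$ on $U$ is concave if for every open $V\subset U$ and every positive Minkowski cycle $\gamma$ on $V$, $f\cdot\gamma$ is positive. *)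

theory Defs
  imports "HOL-Analysis.Analysis"
begin

text \<open>Euclidean polyhedral spaces.  The space X is the type 'x (a second countable
topological space), N_X is the Euclidean space 'n, and the map iota : X -> N_X.
Polyhedra are subsets of X.  Since only complexes on which iota is injective and affine
on every polyhedron are considered, the function space M_sigma of each polyhedron is the
space of restrictions of linear functionals of N_X composed with iota, so a polyhedron
is a closed set sigma such that iota restricted to sigma is a homeomorphism onto a
convex polyhedron of N_X.\<close>

definition poly_face :: "('x \<Rightarrow> 'n::euclidean_space) \<Rightarrow> 'x set \<Rightarrow> 'x set \<Rightarrow> bool" where
  "poly_face \<iota> \<tau> \<sigma> \<longleftrightarrow> (\<exists>F. F face_of (\<iota> ` \<sigma>) \<and> \<tau> = \<sigma> \<inter> \<iota> -` F)"

definition poly_dim :: "('x \<Rightarrow> 'n::euclidean_space) \<Rightarrow> 'x set \<Rightarrow> int" where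
  "poly_dim \<iota> \<sigma> = aff_dim (\<iota> ` \<sigma>)"

definition locally_finite_cover :: "'x::topological_space set set \<Rightarrow> bool" where
  "locally_finite_cover Pc \<longleftrightarrow>
     (\<forall>x. \<exists>N. open N \<and> x \<in> N \<and> finite {\<sigma>\<in>Pc. \<sigma> \<inter> N \<noteq> {}})"

definition eucl_complex ::
  "('x::second_countable_topology \<Rightarrow> 'n::euclidean_space) \<Rightarrow> 'x set set \<Rightarrow> bool" where
  "eucl_complex \<iota> Pc \<longleftrightarrow>
     \<Union>Pc = UNIV \<and> locally_finite_cover Pc \<and>
     (\<forall>\<sigma>\<in>Pc. closed \<sigma> \<and> (\<exists>g. homeomorphism \<sigma> (\<iota> ` \<sigma>) \<iota> g) \<and> polyhedron (\<iota> ` \<sigma>)) \<and>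
     (\<forall>\<sigma>\<in>Pc. \<forall>\<tau>. poly_face \<iota> \<tau> \<sigma> \<longrightarrow> \<tau> \<in> Pc) \<and>
     (\<forall>\<sigma>\<in>Pc. \<forall>\<tau>\<in>Pc. poly_face \<iota> (\<sigma> \<inter> \<tau>) \<sigma> \<and> poly_face \<iota> (\<sigma> \<inter> \<tau>) \<tau>)"

text \<open>Subdivision (the inclusions are automatically affine, both affine structures being
induced by iota).\<close>
definition subdivides :: "'x set set \<Rightarrow> 'x set set \<Rightarrow> bool" where
  "subdivides Pc' Pc \<longleftrightarrow> (\<forall>\<sigma>'\<in>Pc'. \<exists>\<sigma>\<in>Pc. \<sigma>' \<subseteq> \<sigma>)"

definition common_subdiv ::
  "('x::second_countable_topology \<Rightarrow> 'n::euclidean_space) \<Rightarrow> 'x set set \<Rightarrow> 'x set set \<Rightarrow> bool" where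
  "common_subdiv \<iota> Pc1 Pc2 \<longleftrightarrow>
     eucl_complex \<iota> Pc1 \<and> eucl_complex \<iota> Pc2 \<and>
     (\<exists>Pc3. eucl_complex \<iota> Pc3 \<and> subdivides Pc3 Pc1 \<and> subdivides Pc3 Pc2)"

definition structure_class ::
  "('x::second_countable_topology \<Rightarrow> 'n::euclidean_space) \<Rightarrow> 'x set set \<Rightarrow> 'x set set set" where
  "structure_class \<iota> Pc = {Pc'. eucl_complex \<iota> Pc' \<and> (common_subdiv \<iota>)\<^sup>*\<^sup>* Pc Pc'}"

definition cells :: "('x \<Rightarrow> 'n::euclidean_space) \<Rightarrow> 'x set set \<Rightarrow> 'x set \<Rightarrow> int \<Rightarrow> 'x set set" where
  "cells \<iota> Pc V k = {\<sigma>\<in>Pc. \<sigma> \<inter> V \<noteq> {} \<and> poly_dim \<iota> \<sigma> = k}"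

definition normal_vec :: "('x \<Rightarrow> 'n::euclidean_space) \<Rightarrow> 'x set \<Rightarrow> 'x set \<Rightarrow> 'n" where
  "normal_vec \<iota> \<sigma> \<tau> = (SOME v. norm v = 1 \<and>
      (\<forall>a\<in>\<iota> ` \<tau>. \<forall>b\<in>\<iota> ` \<tau>. v \<bullet> (a - b) = 0) \<and>
      v \<in> span {a - b | a b. a \<in> \<iota> ` \<sigma> \<and> b \<in> \<iota> ` \<sigma>} \<and>
      (\<exists>a\<in>\<iota> ` \<sigma>. \<exists>b\<in>\<iota> ` \<tau>. v \<bullet> (a - b) > 0))"

definition minkowski_weight ::
  "('x \<Rightarrow> 'n::euclidean_space) \<Rightarrow> 'x set set \<Rightarrow> 'x set \<Rightarrow> int \<Rightarrow> ('x set \<Rightarrow> real) \<Rightarrow> bool" where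
  "minkowski_weight \<iota> Pc V k c \<longleftrightarrow>
     (\<forall>\<tau>\<in>cells \<iota> Pc V (k - 1).
        (\<Sum>\<sigma>\<in>{\<sigma>\<in>cells \<iota> Pc V k. poly_face \<iota> \<tau> \<sigma>}. c \<sigma> *\<^sub>R normal_vec \<iota> \<sigma> \<tau>) = 0)"

definition positive_weight ::
  "('x \<Rightarrow> 'n::euclidean_space) \<Rightarrow> 'x set set \<Rightarrow> 'x set \<Rightarrow> int \<Rightarrow> ('x set \<Rightarrow> real) \<Rightarrow> bool" where
  "positive_weight \<iota> Pc V k c \<longleftrightarrow> (\<forall>\<sigma>\<in>cells \<iota> Pc V k. c \<sigma> \<ge> 0)"

text \<open>Piecewise affine function on V defined on Pc: affine on each sigma meets V, i.e.
of the form (linear functional) o iota there (as iota X lies in a hyperplane not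
containing 0).\<close>
definition pw_affine ::
  "('x \<Rightarrow> 'n::euclidean_space) \<Rightarrow> 'x set set \<Rightarrow> 'x set \<Rightarrow> ('x \<Rightarrow> real) \<Rightarrow> bool" where
  "pw_affine \<iota> Pc V f \<longleftrightarrow>
     (\<forall>\<sigma>\<in>Pc. \<sigma> \<inter> V \<noteq> {} \<longrightarrow> (\<exists>l. linear l \<and> (\<forall>x\<in>\<sigma> \<inter> V. f x = l (\<iota> x))))"

definition lin_part ::
  "('x \<Rightarrow> 'n::euclidean_space) \<Rightarrow> 'x set \<Rightarrow> ('x \<Rightarrow> real) \<Rightarrow> 'x set \<Rightarrow> 'n \<Rightarrow> real" where
  "lin_part \<iota> V f \<sigma> = (SOME l. linear l \<and> (\<forall>x\<in>\<sigma> \<inter> V. f x = l (\<iota> x)))"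

definition mult_weight ::
  "('x \<Rightarrow> 'n::euclidean_space) \<Rightarrow> 'x set set \<Rightarrow> 'x set \<Rightarrow> int \<Rightarrow> ('x \<Rightarrow> real) \<Rightarrow>
     ('x set \<Rightarrow> real) \<Rightarrow> 'x set \<Rightarrow> real" where
  "mult_weight \<iota> Pc V k f c \<tau> =
     - (\<Sum>\<sigma>\<in>{\<sigma>\<in>cells \<iota> Pc V k. poly_face \<iota> \<tau> \<sigma>}.
          c \<sigma> * lin_part \<iota> V f \<sigma> (normal_vec \<iota> \<sigma> \<tau>))"

definition pullback_weight ::
  "('x \<Rightarrow> 'n::euclidean_space) \<Rightarrow> 'x set set \<Rightarrow> ('x set \<Rightarrow> real) \<Rightarrow> 'x set \<Rightarrow> real" where
  "pullback_weight \<iota> Pc c \<sigma>' =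
     (if \<exists>\<sigma>\<in>Pc. \<sigma>' \<subseteq> \<sigma> \<and> poly_dim \<iota> \<sigma> = poly_dim \<iota> \<sigma>'
      then c (SOME \<sigma>. \<sigma> \<in> Pc \<and> \<sigma>' \<subseteq> \<sigma> \<and> poly_dim \<iota> \<sigma> = poly_dim \<iota> \<sigma>') else 0)"

text \<open>Concavity of a piecewise affine function f on U, relative to the polyhedral space
structure C (a class of complexes).  A positive Minkowski cycle on V is represented by a
positive Minkowski weight c on some complex of C; f . gamma is computed on any complex of
C subdividing the one of c on which f is piecewise affine (positivity of a cycle does not
depend on the representative).\<close>
definition concave_pa ::
  "('x::topological_space \<Rightarrow> 'n::euclidean_space) \<Rightarrow> 'x set set set \<Rightarrow> 'x set \<Rightarrow> ('x \<Rightarrow> real) \<Rightarrow> bool" where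
  "concave_pa \<iota> C U f \<longleftrightarrow>
     (\<exists>Pc\<in>C. pw_affine \<iota> Pc U f) \<and>
     (\<forall>V k Pc1 c Pc2. open V \<and> V \<subseteq> U \<and> Pc1 \<in> C \<and>
        minkowski_weight \<iota> Pc1 V k c \<and> positive_weight \<iota> Pc1 V k c \<and>
        Pc2 \<in> C \<and> subdivides Pc2 Pc1 \<and> pw_affine \<iota> Pc2 V f \<longrightarrow>
        positive_weight \<iota> Pc2 V (k - 1)
          (mult_weight \<iota> Pc2 V k f (pullback_weight \<iota> Pc1 c)))"

end

theory Submission
  imports Defs
begin

text \<open>Cut \<open>Pc\<close> along the finitely many linear hyperplanes \<open>b \<bullet> y = 0\<close> given by the homogenised
inequalities of the polyhedra meeting \<open>U\<close>, and let \<open>h x = (\<Sum>b. \<bar>b \<bullet> \<iota> x\<bar>)\<close>.  If \<open>g\<close> is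
piecewise affine on the cut complex, its linear parts on two cells through \<open>x\<close> agree on the common
kernel of those \<open>b\<close> that vanish at \<open>\<iota> x\<close>, so they differ at \<open>y\<close> by at most a multiple of the sum of
\<open>\<bar>b \<bullet> y\<bar>\<close> over these \<open>b\<close>.  Hence for large \<open>N\<close> both \<open>g - N h\<close> and \<open>- N h\<close> lie near each
point \<open>x\<close> of \<open>U\<close> below a linear function that they touch at \<open>x\<close>.  Such functions are concave: their
slopes in the normal directions at a cell are at most those of the linear function, and the
latter cancel, because Minkowski weights stay balanced under pullback to subdivisions.\<close>

section \<open>Convex geometry\<close>

text \<open>The map \<open>\<iota>\<close> is injective only cell by cell, so X cannot be treated as
  a subset of N_X, and images of different cells through a point may overlap. A support at
  \<open>x\<close> compares the linear part of \<open>g\<close> on one cell with its linear part on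
  another at points that lie in only one of them, so an inequality on all of N_X is needed. The
  linear parts agree on the kernel because the inequalities of all cells meeting \<open>U\<close>
  are among the cutting functionals: a short move from \<open>x\<close> within the kernel and
  parallel to the hyperplane containing the image of \<open>\<iota>\<close> keeps every sign, hence
  stays in both cells and in \<open>U\<close>, where both linear parts compute \<open>g\<close>. One
  \<open>N\<close> serves all points, since the estimate depends only on the two cells and on the
  set of functionals vanishing at \<open>\<iota> x\<close>, which leaves finitely many triples.
  Concavity tests weights on arbitrary complexes of the class, unrelated to the cut complex; a local
  support is a condition on the function alone and so applies to all of them.\<close>

text \<open>Induction on the dimension: a point outside the relative interior lies on a facet, and
  faces of the facet are faces of \<open>S\<close>.\<close>

lemma exists_face_rel_interior:
  fixes S :: "'a::euclidean_space set"
  assumes "polyhedron S" "y \<in> S"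
  shows "\<exists>G. G face_of S \<and> y \<in> rel_interior G"
proof -
  have "\<forall>S. polyhedron S \<longrightarrow> y \<in> S \<longrightarrow> nat (aff_dim S) = n \<longrightarrow> (\<exists>G. G face_of S \<and> y \<in> rel_interior G)" for n
  proof (induction n rule: less_induct)
    case (less n)
    show ?case
    proof (intro allI impI)
      fix S :: "'a set" assume S: "polyhedron S" "y \<in> S" and n: "nat (aff_dim S) = n"
      show "\<exists>G. G face_of S \<and> y \<in> rel_interior G"
      proof (cases "y \<in> rel_interior S")
        case True
        then show ?thesis
          using S face_of_refl polyhedron_imp_convex by blast
      next
        case False
        then obtain F where F: "F facet_of S" "y \<in> F"
          using rel_boundary_of_polyhedron[OF S(1)] S(2) by blast
        have fF: "F face_of S" using F facet_of_imp_face_of by blast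
        have "aff_dim F = aff_dim S - 1" using F by (simp add: facet_of_def)
        moreover have "0 \<le> aff_dim F" using F(2) aff_dim_negative_iff[of F] by (metis empty_iff linorder_not_less)
        ultimately have "nat (aff_dim F) < n" using n by linarith
        moreover have "polyhedron F" using S fF face_of_polyhedron_polyhedron by blast
        ultimately obtain G where "G face_of F" "y \<in> rel_interior G" using less F(2) by blast
        then show ?thesis using fF face_of_trans by blast
      qed
    qed
  qed
  then show ?thesis using assms by blast
qed

text \<open>\<open>G\<close> and \<open>H\<close> are the faces carrying a relative interior point
  \<open>y\<close> of \<open>F\<close>. From any \<open>z\<close> in \<open>G \<inter> H\<close> the
  segment to \<open>y\<close> extends beyond \<open>y\<close> inside both faces, so \<open>y\<close>
  is interior to a segment of \<open>S \<inter> T\<close> ending at \<open>z\<close>, and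
  \<open>F\<close> contains \<open>z\<close>. This makes cut complexes closed under faces.\<close>

lemma face_of_Int_polyhedra:
  fixes S T :: "'a::euclidean_space set"
  assumes S: "polyhedron S" and T: "polyhedron T" and F: "F face_of (S \<inter> T)"
  shows "\<exists>G H. G face_of S \<and> H face_of T \<and> F = G \<inter> H"
proof (cases "F = {}")
  case True
  then show ?thesis by (metis Int_empty_left empty_face_of)
next
  case False
  have cF: "convex F" using F face_of_imp_convex by blast
  then obtain y where y: "y \<in> rel_interior F" using False rel_interior_eq_empty by blast
  have yF: "y \<in> F" using y rel_interior_subset by blast
  have yST: "y \<in> S" "y \<in> T" using yF face_of_imp_subset[OF F] by auto
  obtain G where G: "G face_of S" "y \<in> rel_interior G" using exists_face_rel_interior S yST by blast
  obtain H where H: "H face_of T" "y \<in> rel_interior H" using exists_face_rel_interior T yST by blast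
  have "G \<inter> H face_of S \<inter> T" using G(1) H(1) face_of_Int_Int by blast
  moreover have "y \<in> G \<inter> H" using G H rel_interior_subset by blast
  ultimately have "F \<subseteq> G \<inter> H"
    using subset_of_face_of[of "G \<inter> H" "S \<inter> T" F] face_of_imp_subset[OF F] y by blast
  moreover have "G \<inter> H \<subseteq> F"
  proof
    fix z assume z: "z \<in> G \<inter> H"
    show "z \<in> F"
    proof (cases "z = y")
      case True then show ?thesis using yF by simp
    next
      case False
      have "convex G" "convex H" using G H face_of_imp_convex by auto
      obtain m1 where m1: "m1 > 1" "\<And>e. e > 1 \<Longrightarrow> e \<le> m1 \<Longrightarrow> (1 - e) *\<^sub>R z + e *\<^sub>R y \<in> G"
        using convex_rel_interior_if[OF \<open>convex G\<close> G(2)] z hull_inc[of z G affine] by blast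
      obtain m2 where m2: "m2 > 1" "\<And>e. e > 1 \<Longrightarrow> e \<le> m2 \<Longrightarrow> (1 - e) *\<^sub>R z + e *\<^sub>R y \<in> H"
        using convex_rel_interior_if[OF \<open>convex H\<close> H(2)] z hull_inc[of z H affine] by blast
      \<comment> \<open>The smaller of the two extensions past \<open>y\<close>, so that
        \<open>w\<close> lies in both \<open>G\<close> and \<open>H\<close>.\<close>
      define e where "e = min m1 m2"
      define w where "w = (1 - e) *\<^sub>R z + e *\<^sub>R y"
      have e: "e > 1" "e \<le> m1" "e \<le> m2" using m1 m2 unfolding e_def by auto
      have w: "w \<in> G \<inter> H" unfolding w_def using m1 m2 e by blast
      have "y = (1 - (1 - 1/e)) *\<^sub>R w + (1 - 1/e) *\<^sub>R z"
        using e unfolding w_def by (simp add: scaleR_add_right algebra_simps)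
      moreover have "w \<noteq> z"
      proof
        assume "w = z"
        then have "e *\<^sub>R (y - z) = 0" unfolding w_def by (simp add: algebra_simps)
        then show False using e False by simp
      qed
      moreover have "0 < 1 - 1/e" "1 - 1/e < 1" using e by auto
      ultimately have "y \<in> open_segment w z" unfolding in_segment by blast
      moreover have "w \<in> S \<inter> T" "z \<in> S \<inter> T"
        using w z face_of_imp_subset[OF G(1)] face_of_imp_subset[OF H(1)] by auto
      ultimately show ?thesis using face_ofD[OF F] yF by blast
    qed
  qed
  ultimately show ?thesis using G H by blast
qed

lemma convex_subset_finite_Union_affine:
  fixes S :: "'a::real_vector set"
  assumes "finite \<A>" "\<And>A. A \<in> \<A> \<Longrightarrow> affine A" "convex S" "S \<noteq> {}" "S \<subseteq> \<Union>\<A>"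
  shows "\<exists>A\<in>\<A>. S \<subseteq> A"
  using assms
proof (induction \<A> rule: finite_induct)
  case empty
  then show ?case by auto
next
  case (insert A \<A>)
  show ?case
  proof (cases "S \<subseteq> A")
    case True then show ?thesis by blast
  next
    case False
    then obtain p where p: "p \<in> S" "p \<notin> A" by blast
    have "S \<subseteq> \<Union>\<A>"
    proof
      fix q assume q: "q \<in> S"
      let ?g = "\<lambda>t. p + t *\<^sub>R (q - p)"
      have line: "?g u \<in> B" if "affine B" "?g s \<in> B" "?g t \<in> B" "s \<noteq> t" for B s t u
      proof -
        let ?a = "(t - u) / (t - s)"
        have 1: "?a *\<^sub>R ?g s + (1 - ?a) *\<^sub>R ?g t \<in> B"
          using that(1-3) by (simp add: affine_def)
        have "?a * s + (1 - ?a) * t = u" using that(4) by (simp add: divide_simps) (simp add: algebra_simps)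
        moreover have "?a *\<^sub>R ?g s + (1 - ?a) *\<^sub>R ?g t = p + (?a * s + (1 - ?a) * t) *\<^sub>R (q - p)"
          by (simp add: scaleR_add_left scaleR_add_right scaleR_diff_left)
        ultimately have "?a *\<^sub>R ?g s + (1 - ?a) *\<^sub>R ?g t = ?g u" by simp
        then show ?thesis using 1 by simp
      qed
      have gS: "?g t \<in> S" if "0 \<le> t" "t \<le> 1" for t
        using convexD_alt[OF insert.prems(2) p(1) q that] by (simp add: algebra_simps)
      let ?T = "{t. 0 \<le> t \<and> t \<le> 1 \<and> ?g t \<notin> A}"
      have inj: "s = t" if "?g s \<in> A" "?g t \<in> A" for s t
        using line[of A s t 0] that p insert.prems(1) by auto
      have "finite {t. ?g t \<in> A}"
      proof (cases "\<exists>s. ?g s \<in> A")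
        case True
        then obtain s where "?g s \<in> A" by blast
        then have "{t. ?g t \<in> A} \<subseteq> {s}" using inj by blast
        then show ?thesis by (rule finite_subset) simp
      qed simp
      moreover have "?T = {0..1} - {t. ?g t \<in> A}" by auto
      moreover have "infinite {0..1::real}" by (simp add: infinite_Icc)
      ultimately have "infinite ?T" by (metis (no_types, lifting) Diff_infinite_finite)
      moreover have "?T = (\<Union>B\<in>\<A>. {t \<in> ?T. ?g t \<in> B})"
        using gS insert.prems(4) by blast
      ultimately obtain B where B: "B \<in> \<A>" "infinite {t \<in> ?T. ?g t \<in> B}"
        using insert.hyps(1) by (metis (no_types, lifting) finite_UN)
      then obtain s where s: "?g s \<in> B" using infinite_imp_nonempty by blast
      have "infinite ({t \<in> ?T. ?g t \<in> B} - {s})" using B by simp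
      then obtain t where "?g t \<in> B" "t \<noteq> s" using infinite_imp_nonempty by blast
      then have "?g 1 \<in> B" using line s B insert.prems(1) by blast
      then show "q \<in> \<Union>\<A>" using B by auto
    qed
    then have "\<exists>B\<in>\<A>. S \<subseteq> B" by (intro insert.IH) (use insert.prems in auto)
    then show ?thesis by blast
  qed
qed

text \<open>The linear space parallel to the affine hull, written as the same span that occurs in
  \<open>normal_vec\<close>.\<close>

definition direction :: "'a::euclidean_space set \<Rightarrow> 'a set" where
  "direction S = span {a - b | a b. a \<in> S \<and> b \<in> S}"

lemma subspace_direction [simp]: "subspace (direction S)"
  by (simp add: direction_def)

lemma diff_in_direction: "a \<in> S \<Longrightarrow> b \<in> S \<Longrightarrow> a - b \<in> direction S"
  unfolding direction_def by (rule span_base) blast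

lemma direction_mono: "S \<subseteq> T \<Longrightarrow> direction S \<subseteq> direction T"
  unfolding direction_def by (rule span_mono) blast

lemma direction_eq_span:
  assumes "b \<in> S"
  shows "direction S = span ((\<lambda>a. a - b) ` S)"
proof
  show "direction S \<subseteq> span ((\<lambda>a. a - b) ` S)"
    unfolding direction_def
  proof (rule span_minimal)
    show "{a - b |a b. a \<in> S \<and> b \<in> S} \<subseteq> span ((\<lambda>a. a - b) ` S)"
    proof clarify
      fix a c assume "a \<in> S" "c \<in> S"
      then have "(a - b) - (c - b) \<in> span ((\<lambda>a. a - b) ` S)"
        by (intro span_diff span_base) auto
      then show "a - c \<in> span ((\<lambda>a. a - b) ` S)" by simp
    qed
  qed simp
  show "span ((\<lambda>a. a - b) ` S) \<subseteq> direction S"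
    using assms by (intro span_minimal) (auto intro: diff_in_direction)
qed

lemma dim_direction: "S \<noteq> {} \<Longrightarrow> int (dim (direction S)) = aff_dim S"
proof -
  assume "S \<noteq> {}"
  then obtain b where b: "b \<in> S" by blast
  have "(\<lambda>a. a - b) ` S = (+) (- b) ` S" by (auto simp: image_def)
  then show ?thesis
    using aff_dim_eq_dim[of b S] b by (simp add: direction_eq_span hull_inc)
qed

lemma add_direction_in_affine_hull:
  assumes "b \<in> S" "v \<in> direction S"
  shows "b + v \<in> affine hull S"
proof -
  have "b \<in> affine hull S" using assms hull_inc by fast
  moreover have "v \<in> span ((\<lambda>a. a - b) ` S)" using assms direction_eq_span by blast
  ultimately show ?thesis
    using affine_hull_span_gen[OF \<open>b \<in> affine hull S\<close>] by (auto simp: image_iff algebra_simps)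
qed

lemma affine_hull_diff_in_direction:
  assumes "a \<in> affine hull S" "b \<in> S"
  shows "a - b \<in> direction S"
proof -
  have "b \<in> affine hull S" using assms(2) by (rule hull_inc)
  then show ?thesis
    using assms affine_hull_span_gen[of b S] by (auto simp: direction_eq_span)
qed

lemma direction_eq:
  assumes "S \<subseteq> T" "aff_dim S = aff_dim T"
  shows "direction S = direction T"
proof (cases "S = {}")
  case True
  then show ?thesis using assms by (metis aff_dim_empty)
next
  case False
  then have "T \<noteq> {}" using assms by blast
  then have "dim (direction S) = dim (direction T)" using False assms dim_direction by (metis of_nat_eq_iff)
  then show ?thesis using direction_mono[OF assms(1)] by (simp add: subspace_dim_equal)
qed

lemma rel_interior_add_direction:
  assumes x: "x \<in> rel_interior S" and v: "v \<in> direction S"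
  shows "\<exists>e>0. \<forall>t. \<bar>t\<bar> \<le> e \<longrightarrow> x + t *\<^sub>R v \<in> S"
proof -
  obtain e where e: "e > 0" "cball x e \<inter> affine hull S \<subseteq> S" and xS: "x \<in> S"
    using x mem_rel_interior_cball by blast
  have "x + t *\<^sub>R v \<in> S" if "\<bar>t\<bar> \<le> e / (norm v + 1)" for t
  proof -
    have "norm (t *\<^sub>R v) \<le> e"
    proof -
      have "\<bar>t\<bar> * norm v \<le> \<bar>t\<bar> * (norm v + 1)" by (simp add: mult_left_mono)
      also have "\<dots> \<le> e" using that by (simp add: pos_le_divide_eq add_nonneg_pos)
      finally show ?thesis by simp
    qed
    moreover have "x + t *\<^sub>R v \<in> affine hull S"
      using v xS by (intro add_direction_in_affine_hull) (simp_all add: subspace_scale)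
    ultimately show ?thesis using e(2) by (auto simp: dist_norm)
  qed
  moreover have "e / (norm v + 1) > 0" using e by (simp add: add_nonneg_pos)
  ultimately show ?thesis by blast
qed

section \<open>Unit normals of a subspace of codimension one\<close>

lemma unit_normal_unique:
  fixes S T :: "'a::euclidean_space set"
  assumes "subspace S" "subspace T" "T \<subseteq> S" "dim S = dim T + 1"
    and u: "u \<in> S" "norm u = 1" "\<And>t. t \<in> T \<Longrightarrow> u \<bullet> t = 0"
    and v: "v \<in> S" "norm v = 1" "\<And>t. t \<in> T \<Longrightarrow> v \<bullet> t = 0"
  shows "v = u \<or> v = - u"
proof -
  have "u \<notin> T" using u by (metis inner_eq_zero_iff norm_zero zero_neq_one)
  then have "dim (insert u T) = dim T + 1" using assms(2) by (simp add: dim_insert span_eq_iff[THEN iffD2])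
  then have "span (insert u T) = S"
    using assms(1-4) u by (intro subspace_dim_equal span_minimal) auto
  then obtain k where k: "v - k *\<^sub>R u \<in> T"
    using v(1) assms(2) by (metis span_breakdown_eq span_eq_iff)
  have "(v - k *\<^sub>R u) \<bullet> (v - k *\<^sub>R u) = 0"
    using u(3)[OF k] v(3)[OF k] by (simp add: inner_diff_left)
  then have "v = k *\<^sub>R u" by simp
  moreover have "\<bar>k\<bar> = 1" using calculation u v by simp
  ultimately show ?thesis by (auto simp: abs_if split: if_splits)
qed

lemma exists_unit_normal:
  fixes S T :: "'a::euclidean_space set"
  assumes "subspace S" "subspace T" "T \<subseteq> S" "dim S = dim T + 1"
  shows "\<exists>u\<in>S. norm u = 1 \<and> (\<forall>t\<in>T. u \<bullet> t = 0)"
proof -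
  have "T \<noteq> S" using assms(4) by auto
  then have "span T \<subset> span S" using assms span_eq_iff by blast
  then obtain x where x: "x \<noteq> 0" "x \<in> S" "\<And>y. y \<in> T \<Longrightarrow> orthogonal x y"
    using orthogonal_to_subspace_exists_gen[of T S] assms span_eq_iff by metis
  show ?thesis
    by (rule bexI[of _ "x /\<^sub>R norm x"]) (use x assms(1) in \<open>auto simp: orthogonal_def subspace_scale\<close>)
qed

section \<open>Cells of Euclidean complexes\<close>

lemma poly_face_image:
  assumes "poly_face \<iota> \<tau> \<sigma>"
  shows "\<tau> \<subseteq> \<sigma>" "\<iota> ` \<tau> face_of \<iota> ` \<sigma>"
proof -
  obtain F where F: "F face_of \<iota> ` \<sigma>" "\<tau> = \<sigma> \<inter> \<iota> -` F"
    using assms unfolding poly_face_def by blast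
  then have "\<iota> ` \<tau> = F" using face_of_imp_subset[OF F(1)] by blast
  then show "\<tau> \<subseteq> \<sigma>" "\<iota> ` \<tau> face_of \<iota> ` \<sigma>" using F by auto
qed

lemma eucl_complexD:
  assumes "eucl_complex \<iota> P" "\<sigma> \<in> P"
  shows "closed \<sigma>" "inj_on \<iota> \<sigma>" "polyhedron (\<iota> ` \<sigma>)" "convex (\<iota> ` \<sigma>)"
    "\<And>\<tau>. \<tau> \<in> P \<Longrightarrow> poly_face \<iota> (\<sigma> \<inter> \<tau>) \<sigma>"
    "\<And>\<tau>. poly_face \<iota> \<tau> \<sigma> \<Longrightarrow> \<tau> \<in> P"
    "\<exists>g. homeomorphism \<sigma> (\<iota> ` \<sigma>) \<iota> g"
proof -
  note cx = assms(1)[unfolded eucl_complex_def]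
  have 1: "\<forall>\<sigma>\<in>P. closed \<sigma> \<and> (\<exists>g. homeomorphism \<sigma> (\<iota> ` \<sigma>) \<iota> g) \<and> polyhedron (\<iota> ` \<sigma>)"
    using cx by (elim conjE)
  have 2: "\<forall>\<sigma>\<in>P. \<forall>\<tau>. poly_face \<iota> \<tau> \<sigma> \<longrightarrow> \<tau> \<in> P"
    using cx by (elim conjE)
  have 3: "\<forall>\<sigma>\<in>P. \<forall>\<tau>\<in>P. poly_face \<iota> (\<sigma> \<inter> \<tau>) \<sigma> \<and> poly_face \<iota> (\<sigma> \<inter> \<tau>) \<tau>"
    using cx by (elim conjE)
  show "closed \<sigma>" using bspec[OF 1 assms(2)] by (elim conjE)
  show poly: "polyhedron (\<iota> ` \<sigma>)" using bspec[OF 1 assms(2)] by (elim conjE)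
  show hom: "\<exists>g. homeomorphism \<sigma> (\<iota> ` \<sigma>) \<iota> g" using bspec[OF 1 assms(2)] by (elim conjE)
  show "convex (\<iota> ` \<sigma>)" using poly by (rule polyhedron_imp_convex)
  show "inj_on \<iota> \<sigma>" using hom by (metis homeomorphism_def inj_on_inverseI)
  show "\<And>\<tau>. \<tau> \<in> P \<Longrightarrow> poly_face \<iota> (\<sigma> \<inter> \<tau>) \<sigma>" using bspec[OF 3 assms(2)] by blast
  show "\<And>\<tau>. poly_face \<iota> \<tau> \<sigma> \<Longrightarrow> \<tau> \<in> P" using bspec[OF 2 assms(2)] by blast
qed

lemma eucl_complex_cover: "eucl_complex \<iota> P \<Longrightarrow> \<exists>\<sigma>\<in>P. x \<in> \<sigma>"
  unfolding eucl_complex_def by (elim conjE) (metis UNIV_I UnionE)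

text \<open>Continuity at \<open>x\<close> of the inverse of \<open>\<iota>\<close> on a cell.\<close>
lemma eucl_complex_near:
  assumes P: "eucl_complex \<iota> P" "\<sigma> \<in> P" and x: "x \<in> \<sigma>" "x \<in> V" "open V"
  shows "\<exists>r>0. \<forall>z\<in>\<sigma>. dist (\<iota> z) (\<iota> x) < r \<longrightarrow> z \<in> V"
proof -
  obtain g where "homeomorphism \<sigma> (\<iota> ` \<sigma>) \<iota> g"
    using eucl_complexD(7)[OF P] by blast
  then have "openin (top_of_set (\<iota> ` \<sigma>)) (\<iota> ` (\<sigma> \<inter> V))"
    using x(3) by (metis homeomorphism_imp_open_map openin_open_Int)
  then obtain T where T: "open T" "\<iota> ` (\<sigma> \<inter> V) = \<iota> ` \<sigma> \<inter> T"
    unfolding openin_open by blast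
  then have "\<iota> x \<in> T" using x by blast
  then obtain r where r: "r > 0" "\<And>y. dist y (\<iota> x) < r \<Longrightarrow> y \<in> T"
    using T(1) open_dist by blast
  have "z \<in> V" if "z \<in> \<sigma>" "dist (\<iota> z) (\<iota> x) < r" for z
  proof -
    have "\<iota> z \<in> \<iota> ` (\<sigma> \<inter> V)" using T r that by blast
    then show ?thesis using inj_on_image_mem_iff[OF eucl_complexD(2)[OF P] that(1)] by blast
  qed
  then show ?thesis using r(1) by blast
qed

text \<open>From a neighbourhood meeting finitely many cells, remove those that miss
  \<open>x\<close>; they are closed and finite in number.\<close>

lemma eucl_complex_star:
  assumes P: "eucl_complex \<iota> P"
  shows "\<exists>W. open W \<and> x \<in> W \<and> finite {\<eta>\<in>P. \<eta> \<inter> W \<noteq> {}} \<and> (\<forall>\<eta>\<in>P. \<eta> \<inter> W \<noteq> {} \<longrightarrow> x \<in> \<eta>)"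
proof -
  obtain N where N: "open N" "x \<in> N" "finite {\<eta>\<in>P. \<eta> \<inter> N \<noteq> {}}"
  proof -
    have "locally_finite_cover P" using P unfolding eucl_complex_def by (elim conjE)
    then show ?thesis unfolding locally_finite_cover_def using that by blast
  qed
  let ?B = "{\<eta>\<in>P. \<eta> \<inter> N \<noteq> {} \<and> x \<notin> \<eta>}"
  let ?W = "N - \<Union>?B"
  have "finite ?B" by (rule finite_subset[OF _ N(3)]) blast
  then have "closed (\<Union>?B)" using eucl_complexD(1)[OF P] by blast
  moreover have "finite {\<eta>\<in>P. \<eta> \<inter> ?W \<noteq> {}}" by (rule finite_subset[OF _ N(3)]) blast
  moreover have "x \<in> ?W" using N(2) by blast
  moreover have "\<forall>\<eta>\<in>P. \<eta> \<inter> ?W \<noteq> {} \<longrightarrow> x \<in> \<eta>" by blast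
  ultimately show ?thesis using open_Diff[OF N(1)] by blast
qed

lemma finite_cells_at: "eucl_complex \<iota> P \<Longrightarrow> finite {\<eta>\<in>P. x \<in> \<eta>}"
proof -
  assume "eucl_complex \<iota> P"
  then obtain W where "x \<in> W" "finite {\<eta>\<in>P. \<eta> \<inter> W \<noteq> {}}" using eucl_complex_star[of \<iota> P x] by blast
  moreover have "{\<eta>\<in>P. x \<in> \<eta>} \<subseteq> {\<eta>\<in>P. \<eta> \<inter> W \<noteq> {}}" using \<open>x \<in> W\<close> by blast
  ultimately show ?thesis using finite_subset by blast
qed

lemma exists_carrier_cell:
  assumes P: "eucl_complex \<iota> P"
  shows "\<exists>\<eta>\<in>P. z \<in> \<eta> \<and> \<iota> z \<in> rel_interior (\<iota> ` \<eta>)"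
proof -
  obtain \<sigma> where \<sigma>: "\<sigma> \<in> P" "z \<in> \<sigma>" using eucl_complex_cover[OF P] by blast
  obtain G where G: "G face_of \<iota> ` \<sigma>" "\<iota> z \<in> rel_interior G"
    using exists_face_rel_interior[of "\<iota> ` \<sigma>" "\<iota> z"] eucl_complexD[OF P \<sigma>(1)] \<sigma> by blast
  let ?\<eta> = "\<sigma> \<inter> \<iota> -` G"
  have "poly_face \<iota> ?\<eta> \<sigma>" unfolding poly_face_def using G by blast
  then have "?\<eta> \<in> P" using eucl_complexD(6)[OF P \<sigma>(1)] by blast
  moreover have "\<iota> ` ?\<eta> = G" using face_of_imp_subset[OF G(1)] by blast
  moreover have "z \<in> ?\<eta>" using \<sigma> G rel_interior_subset by blast
  ultimately show ?thesis using G by metis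
qed

lemma subdivides_refl: "subdivides P P"
  unfolding subdivides_def by blast

text \<open>A cell \<open>\<rho>\<close> of \<open>P1\<close> containing \<open>\<eta>\<close> meets
  \<open>\<sigma>\<close> in a face of \<open>\<rho>\<close>, and a face containing a relative
  interior point of a subset contains the subset. With \<open>P1 = P2\<close> this is a statement
  about one complex.\<close>

lemma cell_subset_if_rel_interior_meets:
  assumes P1: "eucl_complex \<iota> P1" and sub: "subdivides P2 P1"
    and \<eta>: "\<eta> \<in> P2" and \<sigma>: "\<sigma> \<in> P1" and z: "z \<in> \<eta>" "z \<in> \<sigma>" "\<iota> z \<in> rel_interior (\<iota> ` \<eta>)"
  shows "\<eta> \<subseteq> \<sigma>"
proof -
  obtain \<rho> where \<rho>: "\<rho> \<in> P1" "\<eta> \<subseteq> \<rho>" using sub \<eta> unfolding subdivides_def by blast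
  have F: "\<iota> ` (\<rho> \<inter> \<sigma>) face_of \<iota> ` \<rho>"
    using poly_face_image(2) eucl_complexD(5)[OF P1 \<rho>(1) \<sigma>] by blast
  have "\<iota> z \<in> \<iota> ` (\<rho> \<inter> \<sigma>)" using z \<rho> by blast
  then have "\<iota> ` \<eta> \<subseteq> \<iota> ` (\<rho> \<inter> \<sigma>)"
    using subset_of_face_of[OF F, of "\<iota> ` \<eta>"] \<rho> z by blast
  then show ?thesis
    using inj_on_image_subset_iff[OF eucl_complexD(2)[OF P1 \<rho>(1)], of \<eta> "\<rho> \<inter> \<sigma>"] \<rho> by blast
qed

text \<open>Turns the sums over cells having \<open>\<tau>\<close> as a face into sums over cells
  through one point \<open>x\<close>, which can be compared between a complex and its
  subdivision.\<close>

lemma poly_face_iff_mem: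
  assumes P: "eucl_complex \<iota> P" and \<tau>: "\<tau> \<in> P" and \<sigma>: "\<sigma> \<in> P"
    and x: "x \<in> \<tau>" "\<iota> x \<in> rel_interior (\<iota> ` \<tau>)"
  shows "poly_face \<iota> \<tau> \<sigma> \<longleftrightarrow> x \<in> \<sigma>"
proof
  assume "x \<in> \<sigma>"
  then have "\<tau> \<subseteq> \<sigma>"
    using cell_subset_if_rel_interior_meets[OF P subdivides_refl \<tau> \<sigma> x(1) _ x(2)] by blast
  then show "poly_face \<iota> \<tau> \<sigma>" using eucl_complexD(5)[OF P \<sigma> \<tau>] by (simp add: Int_absorb1)
qed (use poly_face_image x in blast)

lemma cell_eq_if_subset_same_dim:
  assumes P: "eucl_complex \<iota> P" "\<sigma> \<in> P" "\<rho> \<in> P" and "\<sigma> \<subseteq> \<rho>" "poly_dim \<iota> \<sigma> \<ge> poly_dim \<iota> \<rho>"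
  shows "\<sigma> = \<rho>"
proof -
  have "poly_face \<iota> (\<rho> \<inter> \<sigma>) \<rho>" using eucl_complexD(5)[OF P(1,3,2)] .
  then have "\<iota> ` \<sigma> face_of \<iota> ` \<rho>" using poly_face_image(2) assms(4) by (metis Int_absorb1)
  then have "\<iota> ` \<sigma> = \<iota> ` \<rho>"
    using face_of_aff_dim_lt[of "\<iota> ` \<rho>" "\<iota> ` \<sigma>"] eucl_complexD(4)[OF P(1,3)] assms(5)
    unfolding poly_dim_def by fastforce
  then show ?thesis
    using inj_on_image_eq_iff[OF eucl_complexD(2)[OF P(1,3)]] assms(4) by blast
qed

lemma exists_rel_interior_point:
  assumes P: "eucl_complex \<iota> P" "\<tau> \<in> P" and V: "open V" "\<tau> \<inter> V \<noteq> {}"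
  shows "\<exists>x\<in>\<tau> \<inter> V. \<iota> x \<in> rel_interior (\<iota> ` \<tau>)"
proof -
  obtain p where p: "p \<in> \<tau>" "p \<in> V" using V by blast
  obtain r where r: "r > 0" "\<And>z. z \<in> \<tau> \<Longrightarrow> dist (\<iota> z) (\<iota> p) < r \<Longrightarrow> z \<in> V"
    using eucl_complex_near[OF P p V(1)] by blast
  have "\<iota> p \<in> closure (rel_interior (\<iota> ` \<tau>))"
    unfolding convex_closure_rel_interior[OF eucl_complexD(4)[OF P]]
    using p closure_subset[of "\<iota> ` \<tau>"] by blast
  then obtain y where y: "y \<in> rel_interior (\<iota> ` \<tau>)" "dist y (\<iota> p) < r"
    using r(1) closure_approachable by metis
  then obtain x where "x \<in> \<tau>" "y = \<iota> x" using rel_interior_subset[of "\<iota> ` \<tau>"] by blast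
  then show ?thesis using r y by blast
qed

text \<open>Justifies the choice in \<open>normal_vec\<close>: a unit normal exists in codimension
  one, and its sign can be adjusted. The last property lets slopes along the normal be read off
  inside the cell.\<close>

lemma normal_vec_props:
  assumes P: "eucl_complex \<iota> P" and \<sigma>: "\<sigma> \<in> P" and face: "poly_face \<iota> \<tau> \<sigma>" and ne: "\<tau> \<noteq> {}"
    and dim: "poly_dim \<iota> \<sigma> = poly_dim \<iota> \<tau> + 1"
  defines "n \<equiv> normal_vec \<iota> \<sigma> \<tau>"
  shows "norm n = 1" "\<And>t. t \<in> direction (\<iota> ` \<tau>) \<Longrightarrow> n \<bullet> t = 0" "n \<in> direction (\<iota> ` \<sigma>)"
    "\<And>a b. a \<in> \<iota> ` \<sigma> \<Longrightarrow> b \<in> \<iota> ` \<tau> \<Longrightarrow> n \<bullet> (a - b) \<ge> 0"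
    "\<And>y. y \<in> rel_interior (\<iota> ` \<tau>) \<Longrightarrow> \<exists>e>0. \<forall>t\<in>{0..e}. y + t *\<^sub>R n \<in> \<iota> ` \<sigma>"
proof -
  let ?S = "\<iota> ` \<sigma>" and ?T = "\<iota> ` \<tau>"
  have sub: "?T \<subseteq> ?S" and fT: "?T face_of ?S" using poly_face_image[OF face] by auto
  have cS: "convex ?S" using eucl_complexD(4)[OF P \<sigma>] .
  have dsub: "direction ?T \<subseteq> direction ?S" using sub by (rule direction_mono)
  have ddim: "dim (direction ?S) = dim (direction ?T) + 1"
  proof -
    have "?T \<noteq> {}" "?S \<noteq> {}" using ne sub by auto
    then show ?thesis
      using dim_direction[of ?S] dim_direction[of ?T] dim unfolding poly_dim_def by linarith
  qed
  have ddim2: "aff_dim ?S = aff_dim ?T + 1" using dim unfolding poly_dim_def .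
  obtain u where u: "u \<in> direction ?S" "norm u = 1" "\<And>t. t \<in> direction ?T \<Longrightarrow> u \<bullet> t = 0"
    using exists_unit_normal[OF subspace_direction subspace_direction dsub ddim] by blast
  obtain b where b: "b \<in> ?T" using ne by blast
  have "\<exists>a\<in>?S. u \<bullet> (a - b) \<noteq> 0"
  proof (rule ccontr)
    assume "\<not> ?thesis"
    then have "\<forall>a\<in>?S. a - b \<in> {y. u \<bullet> y = 0}" by auto
    then have "span ((\<lambda>a. a - b) ` ?S) \<subseteq> {y. u \<bullet> y = 0}"
      by (intro span_minimal) (auto simp: subspace_hyperplane)
    moreover have "u \<in> span ((\<lambda>a. a - b) ` ?S)" using u(1) direction_eq_span[of b ?S] b sub by blast
    ultimately have "u \<bullet> u = 0" by blast
    then show False using u(2) by simp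
  qed
  then obtain a where a: "a \<in> ?S" "u \<bullet> (a - b) \<noteq> 0" by blast
  \<comment> \<open>Of the two unit normals, the one pointing to the side of
    \<open>a\<close>.\<close>
  define w where "w = (if u \<bullet> (a - b) > 0 then u else - u)"
  have "norm w = 1 \<and> (\<forall>a\<in>?T. \<forall>b\<in>?T. w \<bullet> (a - b) = 0) \<and>
      w \<in> direction ?S \<and> (\<exists>a\<in>?S. \<exists>b\<in>?T. w \<bullet> (a - b) > 0)"
  proof (intro conjI ballI)
    show "w \<bullet> (c - d) = 0" if "c \<in> ?T" "d \<in> ?T" for c d
      using u(3)[OF diff_in_direction[OF that]] unfolding w_def by simp
    have "w \<bullet> (a - b) > 0" using a(2) unfolding w_def by (auto simp: inner_minus_left)
    then show "\<exists>a\<in>?S. \<exists>b\<in>?T. w \<bullet> (a - b) > 0" using a(1) b by blast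
  qed (use u in \<open>auto simp: w_def subspace_neg\<close>)
  then have n: "norm n = 1 \<and> (\<forall>a\<in>?T. \<forall>b\<in>?T. n \<bullet> (a - b) = 0) \<and>
      n \<in> direction ?S \<and> (\<exists>a\<in>?S. \<exists>b\<in>?T. n \<bullet> (a - b) > 0)"
    unfolding n_def normal_vec_def direction_def by (rule someI)
  then show n1: "norm n = 1" and n3: "n \<in> direction ?S" by auto
  have "direction ?T \<subseteq> {y. n \<bullet> y = 0}"
    unfolding direction_def using n by (intro span_minimal) (auto simp: subspace_hyperplane)
  then show n2: "\<And>t. t \<in> direction ?T \<Longrightarrow> n \<bullet> t = 0" by blast
  obtain a0 b0 where ab0: "a0 \<in> ?S" "b0 \<in> ?T" "n \<bullet> (a0 - b0) > 0" using n by blast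
  have decomp: "\<exists>t\<in>direction ?T. y = t + (n \<bullet> y) *\<^sub>R n" if "y \<in> direction ?S" for y
  proof -
    let ?t = "y - (n \<bullet> y) *\<^sub>R n"
    have t: "?t \<in> direction ?S" using that n3 by (simp add: subspace_diff subspace_scale)
    have "n \<notin> direction ?T" using n1 n2 by force
    then have "dim (insert n (direction ?T)) = dim (direction ?T) + 1"
      by (simp add: dim_insert span_eq_iff[THEN iffD2])
    then have "span (insert n (direction ?T)) = direction ?S"
      using dsub n3 ddim by (intro subspace_dim_equal span_minimal) auto
    then obtain k where k: "?t - k *\<^sub>R n \<in> direction ?T"
      using t by (metis span_breakdown_eq span_eq_iff subspace_direction)
    have "n \<bullet> (?t - k *\<^sub>R n) = 0" using n2 k by blast
    moreover have "n \<bullet> n = 1" using n1 by (simp add: norm_eq_1)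
    ultimately have "k = 0" by (simp add: inner_diff_right)
    then have "?t \<in> direction ?T" using k by simp
    moreover have "y = ?t + (n \<bullet> y) *\<^sub>R n" by simp
    ultimately show ?thesis by blast
  qed
  \<comment> \<open>The definition fixes the sign at one pair only. If \<open>a\<close> were on the
    wrong side, the segment from \<open>a\<close> to \<open>a0\<close> would cross the affine hull
    of \<open>?T\<close>, hence \<open>?T\<close> itself, and the face property would put
    \<open>a\<close> into \<open>?T\<close>.\<close>
  show "n \<bullet> (a - b) \<ge> 0" if a: "a \<in> ?S" and b: "b \<in> ?T" for a b
  proof (rule ccontr)
    assume neg: "\<not> ?thesis"
    have b0: "n \<bullet> b0 = n \<bullet> b" using n b ab0(2) by (metis eq_iff_diff_eq_0 inner_diff_right)
    define p q where "p = n \<bullet> (b - a)" and "q = n \<bullet> (a0 - b)"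
    have pq: "p > 0" "q > 0" using neg ab0(3) b0 unfolding p_def q_def by (auto simp: inner_diff_right)
    \<comment> \<open>\<open>p\<close> and \<open>q\<close> are the distances of \<open>a\<close>
      and \<open>a0\<close> from the separating hyperplane, so \<open>y\<close> is the crossing
      point.\<close>
    define y where "y = (1 - p / (p + q)) *\<^sub>R a + (p / (p + q)) *\<^sub>R a0"
    have fr: "0 < p / (p + q)" "p / (p + q) < 1" using pq by auto
    have "a \<noteq> a0" using pq unfolding p_def q_def by (auto simp: inner_diff_right)
    then have seg: "y \<in> open_segment a a0" unfolding in_segment y_def using fr by blast
    have yS: "y \<in> ?S" unfolding y_def using convexD_alt[OF cS a ab0(1)] fr by simp
    have "n \<bullet> (y - b) = (1 - p / (p + q)) * (n \<bullet> (a - b)) + (p / (p + q)) * (n \<bullet> (a0 - b))"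
      unfolding y_def by (simp add: inner_diff_right inner_add_right algebra_simps)
    also have "\<dots> = (1 - p / (p + q)) * (- p) + (p / (p + q)) * q"
      unfolding p_def q_def by (simp add: inner_diff_right)
    also have "\<dots> = 0" using pq by (simp add: field_simps)
    finally have "n \<bullet> (y - b) = 0" .
    moreover have "y - b \<in> direction ?S" using yS b sub by (intro diff_in_direction) blast+
    ultimately have "y - b \<in> direction ?T" using decomp by force
    then have "y \<in> affine hull ?T" using add_direction_in_affine_hull[OF b] by force
    then have "y \<in> ?T" using face_of_imp_eq_affine_Int[OF cS fT] yS by blast
    then have "a \<in> ?T" using face_ofD[OF fT seg a ab0(1)] by blast
    then show False using n b neg by auto
  qed
  show "\<exists>e>0. \<forall>t\<in>{0..e}. y + t *\<^sub>R n \<in> ?S" if y: "y \<in> rel_interior ?T" for y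
  proof -
    have yT: "y \<in> ?T" using y rel_interior_subset by blast
    define s where "s = n \<bullet> (a0 - y)"
    have "n \<bullet> b0 = n \<bullet> y" using n yT ab0(2) by (metis eq_iff_diff_eq_0 inner_diff_right)
    then have s: "s > 0" using ab0(3) unfolding s_def by (simp add: inner_diff_right)
    obtain t0 where t0: "t0 \<in> direction ?T" "a0 - y = t0 + s *\<^sub>R n"
      using decomp[of "a0 - y"] ab0(1) yT sub unfolding s_def by (meson diff_in_direction subsetD)
    obtain d where d: "d > 0" "\<And>t. \<bar>t\<bar> \<le> d \<Longrightarrow> y + t *\<^sub>R t0 \<in> ?T"
      using rel_interior_add_direction[OF y t0(1)] by blast
    \<comment> \<open>Chosen so that \<open>(1 - k) * d = k\<close>: averaging \<open>a0\<close>
      with the point \<open>y - d t0\<close> of the face then cancels the tangential part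
      \<open>t0\<close> and leaves a pure multiple of \<open>n\<close>.\<close>
    define k where "k = d / (1 + d)"
    have k: "0 < k" "k < 1" "k = (1 - k) * d" using d unfolding k_def by (auto simp: field_simps)
    have "y + (- d) *\<^sub>R t0 \<in> ?S" using d(2)[of "- d"] d(1) sub by auto
    then have "(1 - k) *\<^sub>R (y + (- d) *\<^sub>R t0) + k *\<^sub>R a0 \<in> ?S"
      using convexD_alt[OF cS _ ab0(1)] k by simp
    moreover have "(1 - k) *\<^sub>R (y + (- d) *\<^sub>R t0) + k *\<^sub>R a0 = y + (k * s) *\<^sub>R n"
    proof -
      have "(1 - k) *\<^sub>R (y + (- d) *\<^sub>R t0) + k *\<^sub>R a0
          = (1 - k) *\<^sub>R y - ((1 - k) * d) *\<^sub>R t0 + k *\<^sub>R (y + (t0 + s *\<^sub>R n))"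
        using t0(2) by (simp add: scaleR_add_right algebra_simps)
      also have "\<dots> = y + (k * s) *\<^sub>R n"
        unfolding k(3)[symmetric] by (simp add: algebra_simps)
      finally show ?thesis .
    qed
    ultimately have end_pt: "y + (k * s) *\<^sub>R n \<in> ?S" by simp
    have "y + t *\<^sub>R n \<in> ?S" if "0 \<le> t" "t \<le> k * s" for t
    proof -
      have "(1 - t / (k * s)) *\<^sub>R y + (t / (k * s)) *\<^sub>R (y + (k * s) *\<^sub>R n) \<in> ?S"
        using convexD_alt[OF cS _ end_pt, of y "t / (k * s)"] yT sub that k s by auto
      then show ?thesis using k s by (simp add: algebra_simps)
    qed
    then show ?thesis using k s by (intro exI[of _ "k * s"]) auto
  qed
qed

section \<open>Pullback of Minkowski weights\<close>

lemma pullback_weight_nonneg: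
  assumes "positive_weight \<iota> P1 V k c" "\<sigma> \<inter> V \<noteq> {}" "poly_dim \<iota> \<sigma> = k"
  shows "pullback_weight \<iota> P1 c \<sigma> \<ge> 0"
proof (cases "\<exists>\<rho>\<in>P1. \<sigma> \<subseteq> \<rho> \<and> poly_dim \<iota> \<rho> = poly_dim \<iota> \<sigma>")
  case True
  define \<rho> where "\<rho> = (SOME \<rho>. \<rho> \<in> P1 \<and> \<sigma> \<subseteq> \<rho> \<and> poly_dim \<iota> \<rho> = poly_dim \<iota> \<sigma>)"
  have "\<rho> \<in> P1 \<and> \<sigma> \<subseteq> \<rho> \<and> poly_dim \<iota> \<rho> = poly_dim \<iota> \<sigma>"
    unfolding \<rho>_def by (rule someI_ex) (use True in blast)
  then have "\<rho> \<in> cells \<iota> P1 V k" using assms(2,3) unfolding cells_def by auto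
  then have "c \<rho> \<ge> 0" using assms(1) unfolding positive_weight_def by blast
  then show ?thesis unfolding pullback_weight_def if_P[OF True] \<rho>_def .
next
  case False
  then show ?thesis unfolding pullback_weight_def if_not_P[OF False] by simp
qed

text \<open>Near \<open>x\<close> and on the side of \<open>w\<close>, the cell
  \<open>\<sigma>1\<close> is a convex set \<open>S\<close> of full dimension, covered by the affine
  hulls of finitely many cells of \<open>P2\<close> inside \<open>\<sigma>1\<close>. One of these
  hulls contains all of \<open>S\<close>, so its cell has full dimension. It passes through
  \<open>x\<close>, its normal is \<open>w\<close> or \<open>- w\<close>, and since it meets
  \<open>S\<close> the latter is excluded.\<close>

lemma exists_subdivision_cell_towards:
  assumes P1: "eucl_complex \<iota> P1" and P2: "eucl_complex \<iota> P2" and sub: "subdivides P2 P1"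
    and \<sigma>1: "\<sigma>1 \<in> P1" "x \<in> \<sigma>1" and \<tau>: "\<tau> \<in> P2" "x \<in> \<tau>" "\<iota> x \<in> rel_interior (\<iota> ` \<tau>)"
    and dim: "poly_dim \<iota> \<sigma>1 = poly_dim \<iota> \<tau> + 1"
    and w: "w \<in> direction (\<iota> ` \<sigma>1)" "norm w = 1" "\<And>t. t \<in> direction (\<iota> ` \<tau>) \<Longrightarrow> w \<bullet> t = 0"
    and e: "e > 0" "\<iota> x + e *\<^sub>R w \<in> \<iota> ` \<sigma>1"
  shows "\<exists>\<sigma>\<in>P2. \<sigma> \<subseteq> \<sigma>1 \<and> x \<in> \<sigma> \<and> poly_dim \<iota> \<sigma> = poly_dim \<iota> \<sigma>1 \<and> normal_vec \<iota> \<sigma> \<tau> = w"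
proof -
  obtain W where W: "open W" "x \<in> W" "finite {\<eta>\<in>P2. \<eta> \<inter> W \<noteq> {}}" "\<And>\<eta>. \<eta> \<in> P2 \<Longrightarrow> \<eta> \<inter> W \<noteq> {} \<Longrightarrow> x \<in> \<eta>"
    using eucl_complex_star[OF P2, of x] by blast
  obtain r where r: "r > 0" "\<And>z. z \<in> \<sigma>1 \<Longrightarrow> dist (\<iota> z) (\<iota> x) < r \<Longrightarrow> z \<in> W"
    using eucl_complex_near[OF P1 \<sigma>1 W(2,1)] by blast
  \<comment> \<open>The ball keeps points of \<open>\<sigma>1\<close> in \<open>W\<close>, where all
    cells of \<open>P2\<close> pass through \<open>x\<close>; the open half-space decides the sign
    of the normal.\<close>
  define H where "H = ball (\<iota> x) r \<inter> {y. w \<bullet> (y - \<iota> x) > 0}"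
  define S where "S = \<iota> ` \<sigma>1 \<inter> H"
  have Heq: "H = ball (\<iota> x) r \<inter> {y. w \<bullet> y > w \<bullet> \<iota> x}" unfolding H_def by (simp add: inner_diff_right)
  have cS1: "convex (\<iota> ` \<sigma>1)" using eucl_complexD(4)[OF P1 \<sigma>1(1)] .
  have "open H" "convex H"
    unfolding Heq by (auto intro: open_Int open_halfspace_gt convex_Int convex_ball convex_halfspace_gt)
  have "S \<noteq> {}"
  proof -
    define t where "t = min 1 (r / (2 * e))"
    have t: "0 < t" "t \<le> 1" "t * e < r"
      using e r(1) unfolding t_def by (auto simp: min_def field_simps)
    have "(1 - t) *\<^sub>R \<iota> x + t *\<^sub>R (\<iota> x + e *\<^sub>R w) \<in> \<iota> ` \<sigma>1"
      using convexD_alt[OF cS1 _ e(2), of "\<iota> x" t] \<sigma>1 t by auto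
    then have "\<iota> x + (t * e) *\<^sub>R w \<in> \<iota> ` \<sigma>1" by (simp add: algebra_simps)
    moreover have "\<iota> x + (t * e) *\<^sub>R w \<in> H"
      unfolding H_def using t e(1) w(2) by (simp add: dist_norm dot_square_norm)
    ultimately show ?thesis unfolding S_def by blast
  qed
  have "convex S" unfolding S_def using cS1 \<open>convex H\<close> by (rule convex_Int)
  have dimS: "aff_dim S = aff_dim (\<iota> ` \<sigma>1)"
    using aff_dim_convex_Int_open[OF cS1 \<open>open H\<close>] \<open>S \<noteq> {}\<close> unfolding S_def by blast
  let ?E = "{\<eta>\<in>P2. \<eta> \<inter> W \<noteq> {} \<and> \<eta> \<subseteq> \<sigma>1 \<and> \<iota> ` \<eta> \<inter> S \<noteq> {}}"
  have cover: "S \<subseteq> \<Union>((\<lambda>\<eta>. affine hull (\<iota> ` \<eta>)) ` ?E)"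
  proof
    fix y assume y: "y \<in> S"
    then obtain z where z: "z \<in> \<sigma>1" "y = \<iota> z" unfolding S_def by blast
    have "z \<in> W" using r z y unfolding S_def H_def by (auto simp: dist_commute)
    obtain \<eta> where \<eta>: "\<eta> \<in> P2" "z \<in> \<eta>" "\<iota> z \<in> rel_interior (\<iota> ` \<eta>)"
      using exists_carrier_cell[OF P2] by blast
    have "\<eta> \<subseteq> \<sigma>1"
      using cell_subset_if_rel_interior_meets[OF P1 sub \<eta>(1) \<sigma>1(1) \<eta>(2) z(1) \<eta>(3)] .
    then have "\<eta> \<in> ?E" using \<eta> \<open>z \<in> W\<close> y z by blast
    moreover have "y \<in> affine hull (\<iota> ` \<eta>)" using z \<eta> by (simp add: hull_inc)
    ultimately show "y \<in> \<Union>((\<lambda>\<eta>. affine hull (\<iota> ` \<eta>)) ` ?E)" by blast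
  qed
  have "finite ?E" by (rule finite_subset[OF _ W(3)]) blast
  then have "\<exists>A\<in>(\<lambda>\<eta>. affine hull (\<iota> ` \<eta>)) ` ?E. S \<subseteq> A"
    using \<open>convex S\<close> \<open>S \<noteq> {}\<close> cover
    by (intro convex_subset_finite_Union_affine) (auto simp: affine_affine_hull)
  then obtain \<sigma> where \<sigma>: "\<sigma> \<in> P2" "\<sigma> \<inter> W \<noteq> {}" "\<sigma> \<subseteq> \<sigma>1" "\<iota> ` \<sigma> \<inter> S \<noteq> {}" "S \<subseteq> affine hull (\<iota> ` \<sigma>)"
    by blast
  have x\<sigma>: "x \<in> \<sigma>" using W(4) \<sigma> by blast
  have "aff_dim (\<iota> ` \<sigma>1) \<le> aff_dim (\<iota> ` \<sigma>)"
    using aff_dim_subset[OF \<sigma>(5)] dimS by (simp add: aff_dim_affine_hull)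
  moreover have sub\<sigma>: "\<iota> ` \<sigma> \<subseteq> \<iota> ` \<sigma>1" using \<sigma>(3) by blast
  moreover have "aff_dim (\<iota> ` \<sigma>) \<le> aff_dim (\<iota> ` \<sigma>1)" using sub\<sigma> by (rule aff_dim_subset)
  ultimately have dim\<sigma>: "aff_dim (\<iota> ` \<sigma>) = aff_dim (\<iota> ` \<sigma>1)" by linarith
  have dir\<sigma>: "direction (\<iota> ` \<sigma>) = direction (\<iota> ` \<sigma>1)" using direction_eq[OF sub\<sigma> dim\<sigma>] .
  have face: "poly_face \<iota> \<tau> \<sigma>" using poly_face_iff_mem[OF P2 \<tau>(1) \<sigma>(1) \<tau>(2,3)] x\<sigma> by blast
  have ne: "\<tau> \<noteq> {}" using \<tau> by blast
  have dim2: "poly_dim \<iota> \<sigma> = poly_dim \<iota> \<tau> + 1" using dim dim\<sigma> unfolding poly_dim_def by linarith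
  note n = normal_vec_props[OF P2 \<sigma>(1) face ne dim2]
  have "normal_vec \<iota> \<sigma> \<tau> = w \<or> normal_vec \<iota> \<sigma> \<tau> = - w"
  proof (rule unit_normal_unique)
    show "direction (\<iota> ` \<tau>) \<subseteq> direction (\<iota> ` \<sigma>)"
      using poly_face_image(1)[OF face] by (intro direction_mono) blast
    have "\<iota> ` \<tau> \<noteq> {}" "\<iota> ` \<sigma> \<noteq> {}" using ne x\<sigma> by auto
    then show "dim (direction (\<iota> ` \<sigma>)) = dim (direction (\<iota> ` \<tau>)) + 1"
      using dim_direction[of "\<iota> ` \<tau>"] dim_direction[of "\<iota> ` \<sigma>"] dim2 unfolding poly_dim_def by linarith
  qed (use n w dir\<sigma> in auto)
  moreover have "normal_vec \<iota> \<sigma> \<tau> \<noteq> - w"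
  proof
    assume neg: "normal_vec \<iota> \<sigma> \<tau> = - w"
    obtain y where y: "y \<in> \<iota> ` \<sigma>" "y \<in> S" using \<sigma>(4) by blast
    have "- w \<bullet> (y - \<iota> x) \<ge> 0" using n(4)[OF y(1), of "\<iota> x"] \<tau> neg by auto
    then show False using y(2) unfolding S_def H_def by (simp add: inner_minus_left)
  qed
  ultimately show ?thesis using \<sigma> x\<sigma> dim\<sigma> unfolding poly_dim_def by blast
qed

text \<open>Both cells contain a point of X over \<open>\<iota> x + t w\<close> for small
  \<open>t\<close>, and injectivity of \<open>\<iota>\<close> on the common cell
  \<open>\<sigma>1\<close> makes it the same point. With \<open>\<tau>\<close> it gives the
  intersection the full dimension, so the intersection equals both cells.\<close>

lemma subdivision_cell_towards_unique:
  assumes P1: "eucl_complex \<iota> P1" and P2: "eucl_complex \<iota> P2"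
    and \<sigma>1: "\<sigma>1 \<in> P1" and \<tau>: "\<tau> \<in> P2" "x \<in> \<tau>" "\<iota> x \<in> rel_interior (\<iota> ` \<tau>)"
    and \<sigma>: "\<sigma> \<in> P2" "\<sigma> \<subseteq> \<sigma>1" "x \<in> \<sigma>" "poly_dim \<iota> \<sigma> = poly_dim \<iota> \<tau> + 1"
    and \<rho>: "\<rho> \<in> P2" "\<rho> \<subseteq> \<sigma>1" "x \<in> \<rho>" "poly_dim \<iota> \<rho> = poly_dim \<iota> \<tau> + 1"
    and eq: "normal_vec \<iota> \<sigma> \<tau> = normal_vec \<iota> \<rho> \<tau>"
  shows "\<sigma> = \<rho>"
proof -
  have face: "poly_face \<iota> \<tau> \<sigma>" "poly_face \<iota> \<tau> \<rho>"
    using poly_face_iff_mem[OF P2 \<tau>(1) _ \<tau>(2,3)] \<sigma> \<rho> by blast+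
  have ne: "\<tau> \<noteq> {}" using \<tau> by blast
  define w where "w = normal_vec \<iota> \<sigma> \<tau>"
  note n = normal_vec_props[OF P2 \<sigma>(1) face(1) ne \<sigma>(4), folded w_def]
  note m = normal_vec_props[OF P2 \<rho>(1) face(2) ne \<rho>(4), folded eq w_def]
  obtain e1 where e1: "e1 > 0" "\<And>t. t \<in> {0..e1} \<Longrightarrow> \<iota> x + t *\<^sub>R w \<in> \<iota> ` \<sigma>" using n(5)[OF \<tau>(3)] by blast
  obtain e2 where e2: "e2 > 0" "\<And>t. t \<in> {0..e2} \<Longrightarrow> \<iota> x + t *\<^sub>R w \<in> \<iota> ` \<rho>" using m(5)[OF \<tau>(3)] by blast
  define t where "t = min e1 e2"
  have t: "t > 0" "t \<in> {0..e1}" "t \<in> {0..e2}" using e1(1) e2(1) unfolding t_def by auto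
  obtain a where a: "a \<in> \<sigma>" "\<iota> a = \<iota> x + t *\<^sub>R w" using e1(2)[OF t(2)] by (metis imageE)
  obtain b where b: "b \<in> \<rho>" "\<iota> b = \<iota> x + t *\<^sub>R w" using e2(2)[OF t(3)] by (metis imageE)
  have "a = b" using inj_onD[OF eucl_complexD(2)[OF P1 \<sigma>1], of a b] a b \<sigma> \<rho> by auto
  define y where "y = \<iota> x + t *\<^sub>R w"
  have "y \<notin> affine hull (\<iota> ` \<tau>)"
  proof
    assume "y \<in> affine hull (\<iota> ` \<tau>)"
    then have "y - \<iota> x \<in> direction (\<iota> ` \<tau>)"
      using \<tau>(2) by (intro affine_hull_diff_in_direction) auto
    then have "t *\<^sub>R w \<in> direction (\<iota> ` \<tau>)" unfolding y_def by simp
    then have "w \<bullet> (t *\<^sub>R w) = 0" by (rule n(2))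
    then show False using n(1) t(1) by auto
  qed
  then have "aff_dim (insert y (\<iota> ` \<tau>)) = aff_dim (\<iota> ` \<tau>) + 1" by (simp add: aff_dim_insert)
  moreover have "insert y (\<iota> ` \<tau>) \<subseteq> \<iota> ` (\<sigma> \<inter> \<rho>)"
  proof -
    have "\<tau> \<subseteq> \<sigma> \<inter> \<rho>" using poly_face_image(1)[OF face(1)] poly_face_image(1)[OF face(2)] by blast
    moreover have "a \<in> \<sigma> \<inter> \<rho>" "y = \<iota> a" using a b \<open>a = b\<close> unfolding y_def by auto
    ultimately show ?thesis by blast
  qed
  ultimately have big: "aff_dim (\<iota> ` \<tau>) + 1 \<le> aff_dim (\<iota> ` (\<sigma> \<inter> \<rho>))" by (metis aff_dim_subset)
  have "\<sigma> \<inter> \<rho> \<in> P2" using eucl_complexD(5,6)[OF P2] \<sigma>(1) \<rho>(1) by blast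
  then have "\<sigma> \<inter> \<rho> = \<sigma>" "\<sigma> \<inter> \<rho> = \<rho>"
    using cell_eq_if_subset_same_dim[OF P2] \<sigma> \<rho> big unfolding poly_dim_def by auto
  then show ?thesis by blast
qed

text \<open>Grouping the sum by the \<open>k\<close>-cells of \<open>P1\<close> leaves, for each of
  them, the sum of the normals of the \<open>P2\<close>-cells inside it. What this inner sum is
  depends only on the dimension of the cell \<open>\<tau>1\<close> of \<open>P1\<close> that carries
  \<open>x\<close>.\<close>

lemma minkowski_weight_pullback:
  assumes P1: "eucl_complex \<iota> P1" and P2: "eucl_complex \<iota> P2" and sub: "subdivides P2 P1"
    and V: "open V" and c: "minkowski_weight \<iota> P1 V k c"
  shows "minkowski_weight \<iota> P2 V k (pullback_weight \<iota> P1 c)"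
  unfolding minkowski_weight_def
proof
  fix \<tau> assume "\<tau> \<in> cells \<iota> P2 V (k - 1)"
  then have \<tau>: "\<tau> \<in> P2" "\<tau> \<inter> V \<noteq> {}" "poly_dim \<iota> \<tau> = k - 1" unfolding cells_def by auto
  obtain x where x: "x \<in> \<tau>" "x \<in> V" "\<iota> x \<in> rel_interior (\<iota> ` \<tau>)"
    using exists_rel_interior_point[OF P2 \<tau>(1) V \<tau>(2)] by blast
  obtain \<tau>1 where \<tau>1: "\<tau>1 \<in> P1" "x \<in> \<tau>1" "\<iota> x \<in> rel_interior (\<iota> ` \<tau>1)"
    using exists_carrier_cell[OF P1] by blast
  have "\<tau> \<subseteq> \<tau>1" using cell_subset_if_rel_interior_meets[OF P1 sub \<tau>(1) \<tau>1(1) x(1) \<tau>1(2) x(3)] .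
  then have \<tau>\<tau>1: "\<iota> ` \<tau> \<subseteq> \<iota> ` \<tau>1" by blast
  define T where "T = {\<sigma>\<in>P2. x \<in> \<sigma> \<and> poly_dim \<iota> \<sigma> = k}"
  define D where "D = {\<sigma>\<in>P1. x \<in> \<sigma> \<and> poly_dim \<iota> \<sigma> = k}"
  have Teq: "{\<sigma> \<in> cells \<iota> P2 V k. poly_face \<iota> \<tau> \<sigma>} = T"
    unfolding T_def cells_def using poly_face_iff_mem[OF P2 \<tau>(1) _ x(1,3)] x(2) by blast
  have Deq: "{\<sigma> \<in> cells \<iota> P1 V k. poly_face \<iota> \<tau>1 \<sigma>} = D"
    unfolding D_def cells_def using poly_face_iff_mem[OF P1 \<tau>1(1) _ \<tau>1(2,3)] x(2) by blast
  have fin: "finite T" "finite D"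
    using finite_cells_at[OF P2, of x] finite_cells_at[OF P1, of x] unfolding T_def D_def
    by (auto elim: rev_finite_subset)
  let ?n = "\<lambda>\<sigma>. normal_vec \<iota> \<sigma> \<tau>"
  \<comment> \<open>At most one cell of \<open>D\<close> contains \<open>\<sigma>\<close>, so the
    choice in the pullback is forced, and the empty sum is its default value 0. In this form the
    double sum can be interchanged.\<close>
  have pb: "pullback_weight \<iota> P1 c \<sigma> = (\<Sum>\<sigma>1\<in>{\<sigma>1\<in>D. \<sigma> \<subseteq> \<sigma>1}. c \<sigma>1)" if \<sigma>: "\<sigma> \<in> T" for \<sigma>
  proof (cases "\<exists>\<sigma>1\<in>P1. \<sigma> \<subseteq> \<sigma>1 \<and> poly_dim \<iota> \<sigma>1 = poly_dim \<iota> \<sigma>")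
    case True
    then obtain \<sigma>1 where \<sigma>1: "\<sigma>1 \<in> P1" "\<sigma> \<subseteq> \<sigma>1" "poly_dim \<iota> \<sigma>1 = poly_dim \<iota> \<sigma>" by blast
    have uniq: "\<rho> = \<sigma>1" if "\<rho> \<in> P1" "\<sigma> \<subseteq> \<rho>" "poly_dim \<iota> \<rho> = poly_dim \<iota> \<sigma>" for \<rho>
    proof -
      have "\<rho> \<inter> \<sigma>1 \<in> P1" using eucl_complexD(5,6)[OF P1] that \<sigma>1 by blast
      moreover have "poly_dim \<iota> \<sigma> \<le> poly_dim \<iota> (\<rho> \<inter> \<sigma>1)"
        unfolding poly_dim_def using that \<sigma>1 by (intro aff_dim_subset) blast
      ultimately have "\<rho> \<inter> \<sigma>1 = \<rho>" "\<rho> \<inter> \<sigma>1 = \<sigma>1"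
        using cell_eq_if_subset_same_dim[OF P1] that \<sigma>1 by auto
      then show ?thesis by blast
    qed
    have "(SOME \<rho>. \<rho> \<in> P1 \<and> \<sigma> \<subseteq> \<rho> \<and> poly_dim \<iota> \<rho> = poly_dim \<iota> \<sigma>) = \<sigma>1"
      by (rule some_equality) (use \<sigma>1 uniq in blast)+
    moreover have "{\<rho>\<in>D. \<sigma> \<subseteq> \<rho>} = {\<sigma>1}"
    proof
      have "\<sigma>1 \<in> D" using \<sigma>1 \<sigma> unfolding D_def T_def by auto
      then show "{\<sigma>1} \<subseteq> {\<rho>\<in>D. \<sigma> \<subseteq> \<rho>}" using \<sigma>1 by blast
      show "{\<rho>\<in>D. \<sigma> \<subseteq> \<rho>} \<subseteq> {\<sigma>1}"
      proof
        fix \<rho> assume "\<rho> \<in> {\<rho>\<in>D. \<sigma> \<subseteq> \<rho>}"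
        then have "\<rho> \<in> P1" "\<sigma> \<subseteq> \<rho>" "poly_dim \<iota> \<rho> = poly_dim \<iota> \<sigma>"
          using \<sigma> unfolding D_def T_def by auto
        then have "\<rho> = \<sigma>1" by (rule uniq)
        then show "\<rho> \<in> {\<sigma>1}" by simp
      qed
    qed
    ultimately show ?thesis unfolding pullback_weight_def using True by simp
  next
    case False
    then have none: "{\<sigma>1\<in>D. \<sigma> \<subseteq> \<sigma>1} = {}" using \<sigma> unfolding D_def T_def by auto
    show ?thesis unfolding pullback_weight_def if_not_P[OF False] none by simp
  qed
  let ?w = "\<lambda>\<sigma>1. \<Sum>\<sigma>\<in>{\<sigma>\<in>T. \<sigma> \<subseteq> \<sigma>1}. ?n \<sigma>"
  have "(\<Sum>\<sigma>\<in>T. pullback_weight \<iota> P1 c \<sigma> *\<^sub>R ?n \<sigma>)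
      = (\<Sum>\<sigma>\<in>T. \<Sum>\<sigma>1\<in>{\<sigma>1\<in>D. \<sigma> \<subseteq> \<sigma>1}. c \<sigma>1 *\<^sub>R ?n \<sigma>)"
    by (simp add: pb scaleR_sum_left)
  also have "\<dots> = (\<Sum>\<sigma>1\<in>D. \<Sum>\<sigma>\<in>{\<sigma>\<in>T. \<sigma> \<subseteq> \<sigma>1}. c \<sigma>1 *\<^sub>R ?n \<sigma>)"
    using fin by (rule sum.swap_restrict)
  also have "\<dots> = (\<Sum>\<sigma>1\<in>D. c \<sigma>1 *\<^sub>R ?w \<sigma>1)" by (simp add: scaleR_sum_right)
  also have "\<dots> = 0"
  proof -
    have ne: "\<tau> \<noteq> {}" "\<tau>1 \<noteq> {}" using x \<tau>1 by auto
    have props: "?n \<sigma> \<in> direction (\<iota> ` \<sigma>1)" "norm (?n \<sigma>) = 1"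
        "\<And>t. t \<in> direction (\<iota> ` \<tau>) \<Longrightarrow> ?n \<sigma> \<bullet> t = 0" "\<exists>e>0. \<iota> x + e *\<^sub>R ?n \<sigma> \<in> \<iota> ` \<sigma>1"
      if "\<sigma>1 \<in> D" "\<sigma> \<in> T" "\<sigma> \<subseteq> \<sigma>1" for \<sigma> \<sigma>1
    proof -
      have \<sigma>: "\<sigma> \<in> P2" "x \<in> \<sigma>" "poly_dim \<iota> \<sigma> = k" using that unfolding T_def by auto
      have sub\<sigma>: "\<iota> ` \<sigma> \<subseteq> \<iota> ` \<sigma>1" using that(3) by blast
      have face: "poly_face \<iota> \<tau> \<sigma>" using poly_face_iff_mem[OF P2 \<tau>(1) \<sigma>(1) x(1,3)] \<sigma> by blast
      have dm: "poly_dim \<iota> \<sigma> = poly_dim \<iota> \<tau> + 1" using \<sigma> \<tau> by simp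
      note n = normal_vec_props[OF P2 \<sigma>(1) face ne(1) dm]
      show "?n \<sigma> \<in> direction (\<iota> ` \<sigma>1)" using n(3) direction_mono[OF sub\<sigma>] by blast
      show "norm (?n \<sigma>) = 1" "\<And>t. t \<in> direction (\<iota> ` \<tau>) \<Longrightarrow> ?n \<sigma> \<bullet> t = 0" using n by auto
      obtain e where "e > 0" "\<And>t. t \<in> {0..e} \<Longrightarrow> \<iota> x + t *\<^sub>R ?n \<sigma> \<in> \<iota> ` \<sigma>" using n(5)[OF x(3)] by blast
      then have "e > 0" "\<iota> x + e *\<^sub>R ?n \<sigma> \<in> \<iota> ` \<sigma>1" using sub\<sigma> by force+
      then show "\<exists>e>0. \<iota> x + e *\<^sub>R ?n \<sigma> \<in> \<iota> ` \<sigma>1" by blast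
    qed
    have dims: "dim (direction (\<iota> ` \<sigma>1)) = dim (direction (\<iota> ` \<tau>)) + 1"
      "direction (\<iota> ` \<tau>) \<subseteq> direction (\<iota> ` \<sigma>1)" if "\<sigma>1 \<in> D" for \<sigma>1
    proof -
      have s: "\<sigma>1 \<in> P1" "x \<in> \<sigma>1" "poly_dim \<iota> \<sigma>1 = k" using that unfolding D_def by auto
      have "\<iota> ` \<tau> \<noteq> {}" "\<iota> ` \<sigma>1 \<noteq> {}" using x s by auto
      then show "dim (direction (\<iota> ` \<sigma>1)) = dim (direction (\<iota> ` \<tau>)) + 1"
        using dim_direction[of "\<iota> ` \<tau>"] dim_direction[of "\<iota> ` \<sigma>1"] s \<tau> unfolding poly_dim_def by linarith
      have "\<tau> \<subseteq> \<sigma>1" using cell_subset_if_rel_interior_meets[OF P1 sub \<tau>(1) s(1) x(1) s(2) x(3)] .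
      then show "direction (\<iota> ` \<tau>) \<subseteq> direction (\<iota> ` \<sigma>1)" by (intro direction_mono) blast
    qed
    have exist: "\<exists>\<sigma>\<in>T. \<sigma> \<subseteq> \<sigma>1 \<and> ?n \<sigma> = w"
      if "\<sigma>1 \<in> D" "w \<in> direction (\<iota> ` \<sigma>1)" "norm w = 1" "\<And>t. t \<in> direction (\<iota> ` \<tau>) \<Longrightarrow> w \<bullet> t = 0"
        "e > 0" "\<iota> x + e *\<^sub>R w \<in> \<iota> ` \<sigma>1" for \<sigma>1 w e
    proof -
      have s: "\<sigma>1 \<in> P1" "x \<in> \<sigma>1" "poly_dim \<iota> \<sigma>1 = k" using that unfolding D_def by auto
      then have "poly_dim \<iota> \<sigma>1 = poly_dim \<iota> \<tau> + 1" using \<tau> by simp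
      from exists_subdivision_cell_towards[OF P1 P2 sub s(1,2) \<tau>(1) x(1,3) this that(2-6)]
      show ?thesis unfolding T_def using s(3) by blast
    qed
    have unique: "\<sigma> = \<rho>" if "\<sigma>1 \<in> D" "\<sigma> \<in> T" "\<rho> \<in> T" "\<sigma> \<subseteq> \<sigma>1" "\<rho> \<subseteq> \<sigma>1" "?n \<sigma> = ?n \<rho>" for \<sigma> \<rho> \<sigma>1
      using subdivision_cell_towards_unique[OF P1 P2 _ \<tau>(1) x(1,3), of \<sigma>1 \<sigma> \<rho>] that \<tau>(3)
      unfolding D_def T_def by auto
    \<comment> \<open>\<open>\<tau> \<subseteq> \<tau>1\<close> excludes smaller dimensions. The
      cell \<open>\<tau>\<close> either subdivides a cell of dimension \<open>k - 1\<close>, or is a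
      new wall inside a \<open>k\<close>-cell, or lies inside a larger cell.\<close>
    consider "poly_dim \<iota> \<tau>1 = k - 1" | "poly_dim \<iota> \<tau>1 = k" | "poly_dim \<iota> \<tau>1 > k"
      using aff_dim_subset[OF \<tau>\<tau>1] \<tau>(3) unfolding poly_dim_def by linarith
    then show ?thesis
    proof cases
      case 1
      have "aff_dim (\<iota> ` \<tau>) = aff_dim (\<iota> ` \<tau>1)" using 1 \<tau>(3) unfolding poly_dim_def by simp
      then have dir: "direction (\<iota> ` \<tau>) = direction (\<iota> ` \<tau>1)" using direction_eq[OF \<tau>\<tau>1] by blast
      \<comment> \<open>Exactly one cell of \<open>T\<close> lies in \<open>\<sigma>1\<close>: the
        direction \<open>?v\<close> yields one, the opposite direction leaves
        \<open>\<sigma>1\<close>, and cells with equal normals coincide. The balancing of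
        \<open>c\<close> at \<open>\<tau>1\<close> then finishes this case.\<close>
      have "?w \<sigma>1 = normal_vec \<iota> \<sigma>1 \<tau>1" if \<sigma>1: "\<sigma>1 \<in> D" for \<sigma>1
      proof -
        have s: "\<sigma>1 \<in> P1" "x \<in> \<sigma>1" "poly_dim \<iota> \<sigma>1 = poly_dim \<iota> \<tau>1 + 1" using \<sigma>1 1 unfolding D_def by auto
        have face: "poly_face \<iota> \<tau>1 \<sigma>1" using poly_face_iff_mem[OF P1 \<tau>1(1) s(1) \<tau>1(2,3)] s by blast
        note n = normal_vec_props[OF P1 s(1) face ne(2) s(3)]
        let ?v = "normal_vec \<iota> \<sigma>1 \<tau>1"
        obtain e where e: "e > 0" "\<And>t. t \<in> {0..e} \<Longrightarrow> \<iota> x + t *\<^sub>R ?v \<in> \<iota> ` \<sigma>1" using n(5)[OF \<tau>1(3)] by blast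
        have "\<iota> x + e *\<^sub>R ?v \<in> \<iota> ` \<sigma>1" using e by auto
        then obtain \<sigma> where \<sigma>: "\<sigma> \<in> T" "\<sigma> \<subseteq> \<sigma>1" "?n \<sigma> = ?v"
          using exist[OF \<sigma>1 n(3,1) _ e(1)] n(2) dir by blast
        have "?n \<rho> = ?v" if \<rho>: "\<rho> \<in> T" "\<rho> \<subseteq> \<sigma>1" for \<rho>
        proof -
          note p = props[OF \<sigma>1 \<rho>]
          have "?n \<rho> = ?v \<or> ?n \<rho> = - ?v"
            using unit_normal_unique[OF subspace_direction subspace_direction dims(2)[OF \<sigma>1] dims(1)[OF \<sigma>1] n(3) n(1) _ p(1) p(2)] n(2) p(3) dir
            by blast
          moreover have "?n \<rho> \<noteq> - ?v"
          proof
            assume neg: "?n \<rho> = - ?v"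
            obtain d where d: "d > 0" "\<iota> x + d *\<^sub>R ?n \<rho> \<in> \<iota> ` \<sigma>1" using p(4) by blast
            have "?v \<bullet> (\<iota> x + d *\<^sub>R ?n \<rho> - \<iota> x) \<ge> 0" using n(4)[OF d(2), of "\<iota> x"] \<tau>1(2) by blast
            then have "d * (?v \<bullet> ?v) \<le> 0" using neg by simp
            then show False using d(1) n(1) by (simp add: dot_square_norm)
          qed
          ultimately show ?thesis by blast
        qed
        then have "{\<sigma>\<in>T. \<sigma> \<subseteq> \<sigma>1} = {\<sigma>}" using \<sigma> unique[OF \<sigma>1] by auto
        then show ?thesis using \<sigma> by simp
      qed
      then have "(\<Sum>\<sigma>1\<in>D. c \<sigma>1 *\<^sub>R ?w \<sigma>1) = (\<Sum>\<sigma>1\<in>D. c \<sigma>1 *\<^sub>R normal_vec \<iota> \<sigma>1 \<tau>1)" by simp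
      moreover have "\<tau>1 \<in> cells \<iota> P1 V (k - 1)" using \<tau>1 x 1 unfolding cells_def by blast
      ultimately show ?thesis using c Deq unfolding minkowski_weight_def by auto
    next
      case 2
      have "\<sigma>1 = \<tau>1" if "\<sigma>1 \<in> D" for \<sigma>1
      proof -
        have s: "\<sigma>1 \<in> P1" "x \<in> \<sigma>1" "poly_dim \<iota> \<sigma>1 = k" using that unfolding D_def by auto
        then have "\<tau>1 \<subseteq> \<sigma>1" by (intro poly_face_image(1)[of \<iota>]) (simp add: poly_face_iff_mem[OF P1 \<tau>1(1) s(1) \<tau>1(2,3)])
        then show ?thesis using cell_eq_if_subset_same_dim[OF P1 \<tau>1(1) s(1)] s 2 by simp
      qed
      moreover have \<tau>1D: "\<tau>1 \<in> D" unfolding D_def using \<tau>1 2 by blast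
      ultimately have D1: "D = {\<tau>1}" by blast
      \<comment> \<open>As \<open>x\<close> is relatively interior to \<open>\<tau>1\<close>, both
        \<open>v\<close> and \<open>- v\<close> stay inside. They give exactly two cells of
        \<open>T\<close>, one on each side of \<open>\<tau>\<close>, with cancelling
        normals.\<close>
      obtain v where v: "v \<in> direction (\<iota> ` \<tau>1)" "norm v = 1" "\<And>t. t \<in> direction (\<iota> ` \<tau>) \<Longrightarrow> v \<bullet> t = 0"
        using exists_unit_normal[OF subspace_direction subspace_direction dims(2)[OF \<tau>1D] dims(1)[OF \<tau>1D]] by blast
      obtain e where e: "e > 0" "\<And>t. \<bar>t\<bar> \<le> e \<Longrightarrow> \<iota> x + t *\<^sub>R v \<in> \<iota> ` \<tau>1"
        using rel_interior_add_direction[OF \<tau>1(3) v(1)] by blast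
      have "\<iota> x + e *\<^sub>R v \<in> \<iota> ` \<tau>1" using e by simp
      then obtain \<sigma> where \<sigma>: "\<sigma> \<in> T" "\<sigma> \<subseteq> \<tau>1" "?n \<sigma> = v" using exist[OF \<tau>1D v(1,2) v(3) e(1)] by blast
      have mv: "- v \<in> direction (\<iota> ` \<tau>1)" "norm (- v) = 1" "\<And>t. t \<in> direction (\<iota> ` \<tau>) \<Longrightarrow> - v \<bullet> t = 0"
        using v by (auto simp: subspace_neg)
      have "\<iota> x + e *\<^sub>R (- v) \<in> \<iota> ` \<tau>1" using e(2)[of "- e"] e(1) by simp
      then obtain \<rho> where \<rho>: "\<rho> \<in> T" "\<rho> \<subseteq> \<tau>1" "?n \<rho> = - v" using exist[OF \<tau>1D mv(1,2) mv(3) e(1)] by blast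
      have pm: "?n \<eta> = v \<or> ?n \<eta> = - v" if "\<eta> \<in> T" "\<eta> \<subseteq> \<tau>1" for \<eta>
        using unit_normal_unique[OF subspace_direction subspace_direction dims(2)[OF \<tau>1D] dims(1)[OF \<tau>1D] v(1,2) _ props(1,2)[OF \<tau>1D that]]
          v(3) props(3)[OF \<tau>1D that] by blast
      have "{\<sigma>\<in>T. \<sigma> \<subseteq> \<tau>1} = {\<sigma>, \<rho>}"
      proof
        show "{\<sigma>\<in>T. \<sigma> \<subseteq> \<tau>1} \<subseteq> {\<sigma>, \<rho>}"
        proof
          fix \<eta> assume "\<eta> \<in> {\<sigma>\<in>T. \<sigma> \<subseteq> \<tau>1}"
          then have \<eta>: "\<eta> \<in> T" "\<eta> \<subseteq> \<tau>1" by auto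
          then have "?n \<eta> = ?n \<sigma> \<or> ?n \<eta> = ?n \<rho>" using pm \<sigma>(3) \<rho>(3) by simp
          then show "\<eta> \<in> {\<sigma>, \<rho>}"
            using unique[OF \<tau>1D \<eta>(1) \<sigma>(1) \<eta>(2) \<sigma>(2)] unique[OF \<tau>1D \<eta>(1) \<rho>(1) \<eta>(2) \<rho>(2)] by blast
        qed
        show "{\<sigma>, \<rho>} \<subseteq> {\<sigma>\<in>T. \<sigma> \<subseteq> \<tau>1}" using \<sigma> \<rho> by simp
      qed
      moreover have "\<sigma> \<noteq> \<rho>"
      proof
        assume "\<sigma> = \<rho>"
        then have "v = - v" using \<sigma>(3) \<rho>(3) by simp
        then have "v \<bullet> v = - (v \<bullet> v)" by (metis inner_minus_left)
        then show False using v(2) by (simp add: norm_eq_1)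
      qed
      ultimately show ?thesis using D1 \<sigma> \<rho> by simp
    next
      case 3
      \<comment> \<open>Every cell through \<open>x\<close> contains its carrier
        \<open>\<tau>1\<close>, which is too large to fit into a \<open>k\<close>-cell.\<close>
      have "D = {}"
      proof (rule ccontr)
        assume "D \<noteq> {}"
        then obtain \<sigma>1 where s: "\<sigma>1 \<in> P1" "x \<in> \<sigma>1" "poly_dim \<iota> \<sigma>1 = k" unfolding D_def by blast
        then have "\<tau>1 \<subseteq> \<sigma>1" by (intro poly_face_image(1)[of \<iota>]) (simp add: poly_face_iff_mem[OF P1 \<tau>1(1) s(1) \<tau>1(2,3)])
        then have "poly_dim \<iota> \<tau>1 \<le> poly_dim \<iota> \<sigma>1" unfolding poly_dim_def by (intro aff_dim_subset) blast
        then show False using 3 s by simp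
      qed
      then show ?thesis by simp
    qed
  qed
  finally show "(\<Sum>\<sigma> | \<sigma> \<in> cells \<iota> P2 V k \<and> poly_face \<iota> \<tau> \<sigma>. pullback_weight \<iota> P1 c \<sigma> *\<^sub>R normal_vec \<iota> \<sigma> \<tau>) = 0"
    unfolding Teq .
qed

section \<open>Cutting a complex by hyperplanes\<close>

text \<open>The hyperplane is included so that nonempty faces of members are members again. For
  \<open>b = 0\<close> all three sets are the whole space, so no case distinction is needed.\<close>

definition halves :: "'n::euclidean_space \<Rightarrow> 'n set set" where
  "halves b = {{y. b \<bullet> y \<le> 0}, {y. b \<bullet> y \<ge> 0}, {y. b \<bullet> y = 0}}"

lemma polyhedron_halves: "H \<in> halves b \<Longrightarrow> polyhedron H"
  unfolding halves_def by (auto simp: polyhedron_halfspace_le polyhedron_halfspace_ge polyhedron_hyperplane)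

lemma face_of_halves: "H \<in> halves b \<Longrightarrow> F face_of H \<Longrightarrow> F = {} \<or> F \<in> halves b"
  unfolding halves_def
  by (auto simp: face_of_halfspace_le face_of_halfspace_ge face_of_affine_eq affine_hyperplane)

lemma Int_halves_face_of:
  assumes "H \<in> halves b" "K \<in> halves b"
  shows "H \<inter> K face_of H"
proof -
  consider "H = K" | "H \<inter> K = {y. b \<bullet> y = 0}"
    using assms unfolding halves_def by fastforce
  then show ?thesis
  proof cases
    case 1
    then show ?thesis using assms polyhedron_halves polyhedron_imp_convex face_of_refl by auto
  next
    case 2
    have "{y. b \<bullet> y = 0} face_of H"
      using assms(1) hyperplane_face_of_halfspace_le[of b 0] hyperplane_face_of_halfspace_ge[of b 0]
        face_of_refl[OF convex_hyperplane, of b 0] unfolding halves_def by auto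
    then show ?thesis using 2 by simp
  qed
qed

definition split_complex :: "('x \<Rightarrow> 'n::euclidean_space) \<Rightarrow> 'x set set \<Rightarrow> 'n \<Rightarrow> 'x set set" where
  "split_complex \<iota> P b = (\<lambda>(\<sigma>, H). \<sigma> \<inter> \<iota> -` H) ` (P \<times> halves b)"

lemma split_complexE:
  assumes "\<eta> \<in> split_complex \<iota> P b"
  obtains \<sigma> H where "\<sigma> \<in> P" "H \<in> halves b" "\<eta> = \<sigma> \<inter> \<iota> -` H"
  using assms unfolding split_complex_def by auto

lemma split_complexI: "\<sigma> \<in> P \<Longrightarrow> H \<in> halves b \<Longrightarrow> \<sigma> \<inter> \<iota> -` H \<in> split_complex \<iota> P b"
  unfolding split_complex_def by force

lemma finite_split_complex:
  assumes "finite {\<sigma>\<in>P. \<sigma> \<inter> U \<noteq> {}}"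
  shows "finite {\<eta>\<in>split_complex \<iota> P b. \<eta> \<inter> U \<noteq> {}}"
proof (rule finite_subset)
  show "{\<eta>\<in>split_complex \<iota> P b. \<eta> \<inter> U \<noteq> {}} \<subseteq> (\<lambda>(\<sigma>, H). \<sigma> \<inter> \<iota> -` H) ` ({\<sigma>\<in>P. \<sigma> \<inter> U \<noteq> {}} \<times> halves b)"
    unfolding split_complex_def by fastforce
  show "finite ((\<lambda>(\<sigma>, H). \<sigma> \<inter> \<iota> -` H) ` ({\<sigma>\<in>P. \<sigma> \<inter> U \<noteq> {}} \<times> halves b))"
    using assms by (simp add: halves_def)
qed

text \<open>Closure under faces is the substantial axiom: a face of the polyhedron cut by
  \<open>H\<close> splits into a face of the polyhedron and a face of \<open>H\<close>, and both
  kinds are available again.\<close>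

lemma eucl_complex_split:
  assumes P: "eucl_complex \<iota> P"
  shows "eucl_complex \<iota> (split_complex \<iota> P b)"
proof -
  let ?Q = "split_complex \<iota> P b"
  have img: "\<iota> ` (\<sigma> \<inter> \<iota> -` H) = \<iota> ` \<sigma> \<inter> H" for \<sigma> H by blast
  have 1: "\<Union>?Q = UNIV"
  proof -
    have "x \<in> \<Union>?Q" for x
    proof -
      obtain \<sigma> where \<sigma>: "\<sigma> \<in> P" "x \<in> \<sigma>" using eucl_complex_cover[OF P] by blast
      obtain H where H: "H \<in> halves b" "\<iota> x \<in> H"
        unfolding halves_def using linear[of "b \<bullet> \<iota> x" 0] by blast
      show ?thesis by (rule UnionI[OF split_complexI[OF \<sigma>(1) H(1)]]) (use \<sigma> H in blast)
    qed
    then show ?thesis by blast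
  qed
  have 2: "locally_finite_cover ?Q"
    unfolding locally_finite_cover_def
  proof
    fix x
    obtain N where "open N" "x \<in> N" "finite {\<sigma>\<in>P. \<sigma> \<inter> N \<noteq> {}}"
      using eucl_complex_star[OF P, of x] by blast
    then show "\<exists>N. open N \<and> x \<in> N \<and> finite {\<eta>\<in>?Q. \<eta> \<inter> N \<noteq> {}}"
      using finite_split_complex by blast
  qed
  have 3: "closed \<eta> \<and> (\<exists>g. homeomorphism \<eta> (\<iota> ` \<eta>) \<iota> g) \<and> polyhedron (\<iota> ` \<eta>)" if "\<eta> \<in> ?Q" for \<eta>
  proof -
    obtain \<sigma> H where \<eta>: "\<sigma> \<in> P" "H \<in> halves b" "\<eta> = \<sigma> \<inter> \<iota> -` H" using \<open>\<eta> \<in> ?Q\<close> by (rule split_complexE)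
    note \<sigma> = eucl_complexD[OF P \<eta>(1)]
    obtain g where g: "homeomorphism \<sigma> (\<iota> ` \<sigma>) \<iota> g" using \<sigma>(7) by blast
    have "continuous_on \<sigma> \<iota>" using g unfolding homeomorphism_def by blast
    moreover have "closed H" using polyhedron_halves[OF \<eta>(2)] polyhedron_imp_closed by blast
    ultimately have "closed \<eta>" unfolding \<eta>(3) using \<sigma>(1) by (intro continuous_closed_preimage)
    moreover have "homeomorphism \<eta> (\<iota> ` \<eta>) \<iota> g"
      using g by (rule homeomorphism_of_subsets) (use \<eta>(3) in auto)
    moreover have "polyhedron (\<iota> ` \<eta>)"
      unfolding \<eta>(3) img using \<sigma>(3) polyhedron_halves[OF \<eta>(2)] by (rule polyhedron_Int)
    ultimately show ?thesis by blast
  qed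
  have 4: "\<tau> \<in> ?Q" if "\<eta> \<in> ?Q" "poly_face \<iota> \<tau> \<eta>" for \<eta> \<tau>
  proof -
    obtain \<sigma> H where \<eta>: "\<sigma> \<in> P" "H \<in> halves b" "\<eta> = \<sigma> \<inter> \<iota> -` H" using \<open>\<eta> \<in> ?Q\<close> by (rule split_complexE)
    obtain F where F: "F face_of \<iota> ` \<sigma> \<inter> H" "\<tau> = \<eta> \<inter> \<iota> -` F"
      using \<open>poly_face \<iota> \<tau> \<eta>\<close> unfolding poly_face_def \<eta>(3) img by blast
    obtain G K where GK: "G face_of \<iota> ` \<sigma>" "K face_of H" "F = G \<inter> K"
      using face_of_Int_polyhedra[OF eucl_complexD(3)[OF P \<eta>(1)] polyhedron_halves[OF \<eta>(2)] F(1)] by blast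
    have face: "\<sigma> \<inter> \<iota> -` G' \<in> P" if "G' face_of \<iota> ` \<sigma>" for G'
      using eucl_complexD(6)[OF P \<eta>(1)] that unfolding poly_face_def by blast
    from face_of_halves[OF \<eta>(2) GK(2)] show ?thesis
    proof
      assume "K = {}"
      then have "\<tau> = (\<sigma> \<inter> \<iota> -` {}) \<inter> \<iota> -` H" using F GK by simp
      then show ?thesis using split_complexI[OF face[OF empty_face_of] \<eta>(2)] by simp
    next
      assume K: "K \<in> halves b"
      have "K \<subseteq> H" using GK(2) by (rule face_of_imp_subset)
      then have "\<tau> = (\<sigma> \<inter> \<iota> -` G) \<inter> \<iota> -` K" unfolding F(2) GK(3) \<eta>(3) by blast
      then show ?thesis using split_complexI[OF face[OF GK(1)] K] by simp
    qed
  qed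
  have 5: "poly_face \<iota> (\<eta> \<inter> \<theta>) \<eta>" if "\<eta> \<in> ?Q" "\<theta> \<in> ?Q" for \<eta> \<theta>
  proof -
    obtain \<sigma> H where \<eta>: "\<sigma> \<in> P" "H \<in> halves b" "\<eta> = \<sigma> \<inter> \<iota> -` H" using \<open>\<eta> \<in> ?Q\<close> by (rule split_complexE)
    obtain \<rho> K where \<theta>: "\<rho> \<in> P" "K \<in> halves b" "\<theta> = \<rho> \<inter> \<iota> -` K" using \<open>\<theta> \<in> ?Q\<close> by (rule split_complexE)
    have "\<iota> ` (\<sigma> \<inter> \<rho>) face_of \<iota> ` \<sigma>"
      using eucl_complexD(5)[OF P \<eta>(1) \<theta>(1)] by (rule poly_face_image)
    then have "(\<iota> ` (\<sigma> \<inter> \<rho>)) \<inter> (H \<inter> K) face_of \<iota> ` \<eta>"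
      unfolding \<eta>(3) img using Int_halves_face_of[OF \<eta>(2) \<theta>(2)] by (rule face_of_Int_Int)
    \<comment> \<open>Going back from images to X is possible because both points concerned lie in
      \<open>\<sigma>\<close>, where \<open>\<iota>\<close> is injective.\<close>
    moreover have "\<eta> \<inter> \<theta> = \<eta> \<inter> \<iota> -` ((\<iota> ` (\<sigma> \<inter> \<rho>)) \<inter> (H \<inter> K))"
    proof
      show "\<eta> \<inter> \<theta> \<subseteq> \<eta> \<inter> \<iota> -` ((\<iota> ` (\<sigma> \<inter> \<rho>)) \<inter> (H \<inter> K))" unfolding \<eta>(3) \<theta>(3) by blast
      show "\<eta> \<inter> \<iota> -` ((\<iota> ` (\<sigma> \<inter> \<rho>)) \<inter> (H \<inter> K)) \<subseteq> \<eta> \<inter> \<theta>"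
      proof
        fix z assume z: "z \<in> \<eta> \<inter> \<iota> -` ((\<iota> ` (\<sigma> \<inter> \<rho>)) \<inter> (H \<inter> K))"
        then have "z \<in> \<sigma>" "\<iota> z \<in> \<iota> ` (\<sigma> \<inter> \<rho>)" unfolding \<eta>(3) by auto
        then have "z \<in> \<sigma> \<inter> \<rho>"
          using inj_on_image_mem_iff[OF eucl_complexD(2)[OF P \<eta>(1)], of z "\<sigma> \<inter> \<rho>"] by blast
        then show "z \<in> \<eta> \<inter> \<theta>" using z unfolding \<theta>(3) by blast
      qed
    qed
    ultimately show ?thesis unfolding poly_face_def by blast
  qed
  have 6: "\<forall>\<eta>\<in>?Q. \<forall>\<theta>\<in>?Q. poly_face \<iota> (\<eta> \<inter> \<theta>) \<eta> \<and> poly_face \<iota> (\<eta> \<inter> \<theta>) \<theta>"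
    using 5 by (metis Int_commute)
  show ?thesis
    unfolding eucl_complex_def
    by (intro conjI 1 2 6 ballI allI impI) (use 3 4 in \<open>simp_all\<close>)
qed

text \<open>The last clause is what the induction has to carry: inside its surrounding cell
  \<open>\<sigma>\<close> of \<open>P\<close>, a cell \<open>\<rho>\<close> is a union of sign
  classes. So a move within \<open>\<sigma>\<close> that preserves all signs cannot leave
  \<open>\<rho>\<close>.\<close>

lemma exists_arrangement_subdivision:
  assumes P: "eucl_complex \<iota> P" and fin: "finite {\<sigma>\<in>P. \<sigma> \<inter> U \<noteq> {}}" and A: "finite A"
  shows "\<exists>Q. eucl_complex \<iota> Q \<and> subdivides Q P \<and> finite {\<rho>\<in>Q. \<rho> \<inter> U \<noteq> {}} \<and>
    (\<forall>\<rho>\<in>Q. \<forall>b\<in>A. (\<forall>z\<in>\<rho>. b \<bullet> \<iota> z \<le> 0) \<or> (\<forall>z\<in>\<rho>. b \<bullet> \<iota> z \<ge> 0)) \<and>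
    (\<forall>\<rho>\<in>Q. \<exists>\<sigma>\<in>P. \<rho> \<subseteq> \<sigma> \<and>
       (\<forall>x\<in>\<rho>. \<forall>w\<in>\<sigma>. (\<forall>b\<in>A. sgn (b \<bullet> \<iota> w) = sgn (b \<bullet> \<iota> x)) \<longrightarrow> w \<in> \<rho>))"
  using A
proof (induction A rule: finite_induct)
  case empty
  have "\<forall>\<rho>\<in>P. \<exists>\<sigma>\<in>P. \<rho> \<subseteq> \<sigma> \<and> (\<forall>x\<in>\<rho>. \<forall>w\<in>\<sigma>. w \<in> \<rho>)" by blast
  then show ?case using P fin subdivides_refl by (intro exI[of _ P]) simp
next
  case (insert a A)
  obtain Q where Q: "eucl_complex \<iota> Q" "finite {\<rho>\<in>Q. \<rho> \<inter> U \<noteq> {}}"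
    and sign: "\<forall>\<rho>\<in>Q. \<forall>b\<in>A. (\<forall>z\<in>\<rho>. b \<bullet> \<iota> z \<le> 0) \<or> (\<forall>z\<in>\<rho>. b \<bullet> \<iota> z \<ge> 0)"
    and ref: "\<forall>\<rho>\<in>Q. \<exists>\<sigma>\<in>P. \<rho> \<subseteq> \<sigma> \<and>
       (\<forall>x\<in>\<rho>. \<forall>w\<in>\<sigma>. (\<forall>b\<in>A. sgn (b \<bullet> \<iota> w) = sgn (b \<bullet> \<iota> x)) \<longrightarrow> w \<in> \<rho>)"
    using insert.IH by (elim exE conjE) (rule that)
  let ?R = "split_complex \<iota> Q a"
  have ref': "\<exists>\<sigma>\<in>P. \<eta> \<subseteq> \<sigma> \<and>
       (\<forall>x\<in>\<eta>. \<forall>w\<in>\<sigma>. (\<forall>b\<in>insert a A. sgn (b \<bullet> \<iota> w) = sgn (b \<bullet> \<iota> x)) \<longrightarrow> w \<in> \<eta>)"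
    if "\<eta> \<in> ?R" for \<eta>
  proof -
    obtain \<rho> H where \<eta>: "\<rho> \<in> Q" "H \<in> halves a" "\<eta> = \<rho> \<inter> \<iota> -` H" using \<open>\<eta> \<in> ?R\<close> by (rule split_complexE)
    obtain \<sigma> where \<sigma>: "\<sigma> \<in> P" "\<rho> \<subseteq> \<sigma>"
      "\<forall>x\<in>\<rho>. \<forall>w\<in>\<sigma>. (\<forall>b\<in>A. sgn (b \<bullet> \<iota> w) = sgn (b \<bullet> \<iota> x)) \<longrightarrow> w \<in> \<rho>"
      using bspec[OF ref \<eta>(1)] by (elim bexE conjE) (rule that)
    have "w \<in> \<eta>" if x: "x \<in> \<eta>" and w: "w \<in> \<sigma>" and sg: "\<forall>b\<in>insert a A. sgn (b \<bullet> \<iota> w) = sgn (b \<bullet> \<iota> x)" for x w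
    proof -
      have "w \<in> \<rho>" using \<sigma>(3) x w sg unfolding \<eta>(3) by blast
      moreover have "sgn (a \<bullet> \<iota> w) = sgn (a \<bullet> \<iota> x)" "\<iota> x \<in> H" using sg x \<eta>(3) by auto
      \<comment> \<open>Each member of \<open>halves a\<close> is described by the sign of
        \<open>a\<close> alone.\<close>
      then have "\<iota> w \<in> H" using \<eta>(2) unfolding halves_def by (auto simp: sgn_if split: if_splits)
      ultimately show ?thesis using \<eta>(3) by simp
    qed
    moreover have "\<eta> \<subseteq> \<sigma>" using \<sigma>(2) \<eta>(3) by blast
    ultimately show ?thesis using \<sigma>(1) by (intro bexI[of _ \<sigma>] conjI ballI impI)
  qed
  have sign': "(\<forall>z\<in>\<eta>. b \<bullet> \<iota> z \<le> 0) \<or> (\<forall>z\<in>\<eta>. b \<bullet> \<iota> z \<ge> 0)" if "\<eta> \<in> ?R" "b \<in> insert a A" for \<eta> b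
  proof -
    obtain \<rho> H where \<eta>: "\<rho> \<in> Q" "H \<in> halves a" "\<eta> = \<rho> \<inter> \<iota> -` H" using \<open>\<eta> \<in> ?R\<close> by (rule split_complexE)
    show ?thesis
    proof (cases "b \<in> A")
      case True
      then show ?thesis using bspec[OF bspec[OF sign \<eta>(1)] True] unfolding \<eta>(3) by blast
    next
      case False
      then have "b = a" using that by simp
      then show ?thesis using \<eta>(2,3) unfolding halves_def by auto
    qed
  qed
  have "subdivides ?R P" unfolding subdivides_def using ref' by meson
  then show ?case
    using eucl_complex_split[OF Q(1)] finite_split_complex[OF Q(2)] sign' ref'
    by (intro exI[of _ ?R] conjI ballI)
qed

section \<open>Concavity from local supports\<close>

text \<open>The minus sign in \<open>mult_weight\<close> turns an upper bound for the slopes into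
  positivity. Nothing relates the complexes \<open>P1\<close> and \<open>P2\<close> to the one on
  which \<open>F\<close> was found to be piecewise affine.\<close>

lemma concave_pa_if_local_support:
  assumes C: "\<And>P. P \<in> C \<Longrightarrow> eucl_complex \<iota> P" and pa: "\<exists>P\<in>C. pw_affine \<iota> P U F"
    and support: "\<And>x. x \<in> U \<Longrightarrow> \<exists>L W. linear L \<and> open W \<and> x \<in> W \<and> F x = L (\<iota> x) \<and> (\<forall>z\<in>W \<inter> U. F z \<le> L (\<iota> z))"
  shows "concave_pa \<iota> C U F"
  unfolding concave_pa_def
proof (intro conjI allI impI, rule pa)
  fix V k P1 c P2
  assume "open V \<and> V \<subseteq> U \<and> P1 \<in> C \<and> minkowski_weight \<iota> P1 V k c \<and> positive_weight \<iota> P1 V k c \<and>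
    P2 \<in> C \<and> subdivides P2 P1 \<and> pw_affine \<iota> P2 V F"
  then have V: "open V" "V \<subseteq> U" and P1: "eucl_complex \<iota> P1" and P2: "eucl_complex \<iota> P2"
    and c: "minkowski_weight \<iota> P1 V k c" "positive_weight \<iota> P1 V k c"
    and sub: "subdivides P2 P1" and F: "pw_affine \<iota> P2 V F" using C by auto
  let ?c = "pullback_weight \<iota> P1 c"
  show "positive_weight \<iota> P2 V (k - 1) (mult_weight \<iota> P2 V k F ?c)"
    unfolding positive_weight_def
  proof
    fix \<tau> assume \<tau>cell: "\<tau> \<in> cells \<iota> P2 V (k - 1)"
    then have \<tau>: "\<tau> \<in> P2" "\<tau> \<inter> V \<noteq> {}" "poly_dim \<iota> \<tau> = k - 1" unfolding cells_def by auto
    obtain x where x: "x \<in> \<tau>" "x \<in> V" "\<iota> x \<in> rel_interior (\<iota> ` \<tau>)"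
      using exists_rel_interior_point[OF P2 \<tau>(1) V(1) \<tau>(2)] by blast
    have "x \<in> U" using V x by blast
    from support[OF this] obtain L W where L: "linear L" "open W" "x \<in> W" "F x = L (\<iota> x)"
      "\<forall>z\<in>W \<inter> U. F z \<le> L (\<iota> z)" by (elim exE conjE) (rule that)
    let ?T = "{\<sigma> \<in> cells \<iota> P2 V k. poly_face \<iota> \<tau> \<sigma>}"
    let ?n = "\<lambda>\<sigma>. normal_vec \<iota> \<sigma> \<tau>"
    have le: "?c \<sigma> * lin_part \<iota> V F \<sigma> (?n \<sigma>) \<le> ?c \<sigma> * L (?n \<sigma>)" if "\<sigma> \<in> ?T" for \<sigma>
    proof (rule mult_left_mono)
      have \<sigma>: "\<sigma> \<in> P2" "\<sigma> \<inter> V \<noteq> {}" "poly_dim \<iota> \<sigma> = k" and face: "poly_face \<iota> \<tau> \<sigma>"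
        using that unfolding cells_def by auto
      show "?c \<sigma> \<ge> 0" using pullback_weight_nonneg[OF c(2) \<sigma>(2,3)] .
      have ne: "\<tau> \<noteq> {}" using x by blast
      have dim: "poly_dim \<iota> \<sigma> = poly_dim \<iota> \<tau> + 1" using \<sigma> \<tau> by simp
      note n = normal_vec_props[OF P2 \<sigma>(1) face ne dim]
      have x\<sigma>: "x \<in> \<sigma>" using poly_face_image(1)[OF face] x by blast
      have xVW: "x \<in> V \<inter> W" "open (V \<inter> W)" using x L V by auto
      obtain r where r: "r > 0" "\<forall>z\<in>\<sigma>. dist (\<iota> z) (\<iota> x) < r \<longrightarrow> z \<in> V \<inter> W"
        using eucl_complex_near[OF P2 \<sigma>(1) x\<sigma> xVW] by blast
      obtain e where e: "e > 0" "\<forall>t\<in>{0..e}. \<iota> x + t *\<^sub>R ?n \<sigma> \<in> \<iota> ` \<sigma>" using n(5)[OF x(3)] by blast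
      \<comment> \<open>Small enough that the point over \<open>\<iota> x + t n\<close> is in
        \<open>\<sigma>\<close>, in \<open>W\<close> for the support inequality, and in
        \<open>V\<close>, where \<open>lin_part\<close> represents \<open>F\<close>.\<close>
      define t where "t = min e (r / 2)"
      have t: "0 < t" "t \<le> e" "t < r" using e r unfolding t_def by auto
      have "\<iota> x + t *\<^sub>R ?n \<sigma> \<in> \<iota> ` \<sigma>" using e(2) t by simp
      then obtain z where z: "z \<in> \<sigma>" "\<iota> z = \<iota> x + t *\<^sub>R ?n \<sigma>" by (metis imageE)
      have "dist (\<iota> z) (\<iota> x) < r" using z(2) n(1) t by (simp add: dist_norm)
      then have zVW: "z \<in> V \<inter> W" using r z by blast
      let ?l = "lin_part \<iota> V F \<sigma>"
      \<comment> \<open>A linear part need not be unique on N_X. Its values at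
        \<open>\<iota> x\<close> and \<open>\<iota> z\<close> already fix its slope along the
        normal.\<close>
      have "linear ?l \<and> (\<forall>x\<in>\<sigma> \<inter> V. F x = ?l (\<iota> x))"
        unfolding lin_part_def
        using someI_ex[OF mp[OF bspec[OF F[unfolded pw_affine_def] \<sigma>(1)] \<sigma>(2)]] .
      then have l: "linear ?l" "F x = ?l (\<iota> x)" "F z = ?l (\<iota> z)" using x x\<sigma> z zVW by auto
      have "F z \<le> L (\<iota> z)" using L(5) zVW V by blast
      then have "?l (\<iota> x) + t * ?l (?n \<sigma>) \<le> L (\<iota> x) + t * L (?n \<sigma>)"
        using l(1,3) L(1) z(2) by (simp add: linear_add linear_scale)
      then have "t * ?l (?n \<sigma>) \<le> t * L (?n \<sigma>)" using l(2) L(4) by simp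
      then show "?l (?n \<sigma>) \<le> L (?n \<sigma>)" using t(1) by simp
    qed
    have "(\<Sum>\<sigma>\<in>?T. ?c \<sigma> * lin_part \<iota> V F \<sigma> (?n \<sigma>)) \<le> (\<Sum>\<sigma>\<in>?T. ?c \<sigma> * L (?n \<sigma>))"
      by (rule sum_mono) (rule le)
    also have "\<dots> = L (\<Sum>\<sigma>\<in>?T. ?c \<sigma> *\<^sub>R ?n \<sigma>)"
      by (simp add: linear_sum[OF L(1)] linear_scale[OF L(1)])
    also have "(\<Sum>\<sigma>\<in>?T. ?c \<sigma> *\<^sub>R ?n \<sigma>) = 0"
      by (rule bspec[OF minkowski_weight_pullback[OF P1 P2 sub V(1) c(1), unfolded minkowski_weight_def] \<tau>cell])
    also have "L 0 = 0" using L(1) by (rule linear_0)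
    finally show "mult_weight \<iota> P2 V k F ?c \<tau> \<ge> 0" unfolding mult_weight_def by simp
  qed
qed

section \<open>Homogeneous inequalities, stable signs and bounds for linear functionals\<close>

lemma polyhedron_in_hyperplane:
  fixes S :: "'a::euclidean_space set"
  assumes "polyhedron S" and e: "\<And>y. y \<in> S \<Longrightarrow> e \<bullet> y = 1"
  shows "\<exists>A. finite A \<and> S = {y. e \<bullet> y = 1 \<and> (\<forall>b\<in>A. b \<bullet> y \<le> 0)}"
proof -
  obtain F where F: "finite F" "S = \<Inter>F" "\<forall>h\<in>F. \<exists>a b. a \<noteq> 0 \<and> h = {x. a \<bullet> x \<le> b}"
    using assms(1) unfolding polyhedron_def by blast
  obtain a b where ab: "\<And>h. h \<in> F \<Longrightarrow> h = {x. a h \<bullet> x \<le> b h}" using F(3) by metis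
  \<comment> \<open>On the hyperplane \<open>e \<bullet> y = 1\<close> the constant
    \<open>b h\<close> equals \<open>(b h *\<^sub>R e) \<bullet> y\<close>, so every affine
    inequality becomes linear.\<close>
  have "S = {y. e \<bullet> y = 1 \<and> (\<forall>h\<in>F. (a h - b h *\<^sub>R e) \<bullet> y \<le> 0)}"
  proof (intro equalityI subsetI)
    fix y assume y: "y \<in> S"
    have "a h \<bullet> y \<le> b h" if "h \<in> F" for h using ab[OF that] y F(2) that by blast
    then show "y \<in> {y. e \<bullet> y = 1 \<and> (\<forall>h\<in>F. (a h - b h *\<^sub>R e) \<bullet> y \<le> 0)}"
      using e[OF y] by (simp add: inner_diff_left)
  next
    fix y assume "y \<in> {y. e \<bullet> y = 1 \<and> (\<forall>h\<in>F. (a h - b h *\<^sub>R e) \<bullet> y \<le> 0)}"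
    then have "e \<bullet> y = 1" "\<forall>h\<in>F. (a h - b h *\<^sub>R e) \<bullet> y \<le> 0" by auto
    then have "\<forall>h\<in>F. a h \<bullet> y \<le> b h" by (simp add: inner_diff_left)
    then have "\<forall>h\<in>F. y \<in> h" using ab by blast
    then show "y \<in> S" using F(2) by blast
  qed
  then show ?thesis using F(1) by (intro exI[of _ "(\<lambda>h. a h - b h *\<^sub>R e) ` F"]) simp
qed

text \<open>Nonzero signs survive small perturbations, and the functionals vanishing at
  \<open>p\<close> vanish along \<open>y\<close> as well.\<close>

lemma sgn_inner_stable:
  fixes p y :: "'a::euclidean_space"
  assumes "finite A" "\<forall>b\<in>A. b \<bullet> p = 0 \<longrightarrow> b \<bullet> y = 0"
  shows "\<exists>e>0. \<forall>t. \<bar>t\<bar> \<le> e \<longrightarrow> (\<forall>b\<in>A. sgn (b \<bullet> (p + t *\<^sub>R y)) = sgn (b \<bullet> p))"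
  using assms
proof (induction A rule: finite_induct)
  case empty
  then show ?case by (intro exI[of _ 1]) simp
next
  case (insert a A)
  then obtain e where e: "e > 0" "\<forall>t. \<bar>t\<bar> \<le> e \<longrightarrow> (\<forall>b\<in>A. sgn (b \<bullet> (p + t *\<^sub>R y)) = sgn (b \<bullet> p))"
    by auto
  have "\<exists>d>0. \<forall>t. \<bar>t\<bar> \<le> d \<longrightarrow> sgn (a \<bullet> (p + t *\<^sub>R y)) = sgn (a \<bullet> p)"
  proof (cases "a \<bullet> p = 0")
    case True
    then show ?thesis using insert.prems by (intro exI[of _ 1]) (simp add: inner_add_right)
  next
    case False
    \<comment> \<open>The summand 1 avoids a zero denominator and makes the resulting bound on
      \<open>t * (a \<bullet> y)\<close> strict.\<close>
    define d where "d = \<bar>a \<bullet> p\<bar> / (\<bar>a \<bullet> y\<bar> + 1)"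
    have "sgn (a \<bullet> (p + t *\<^sub>R y)) = sgn (a \<bullet> p)" if "\<bar>t\<bar> \<le> d" for t
    proof -
      have "\<bar>t\<bar> * (\<bar>a \<bullet> y\<bar> + 1) \<le> \<bar>a \<bullet> p\<bar>" using that unfolding d_def by (simp add: pos_le_divide_eq add_nonneg_pos)
      moreover have "\<bar>t * (a \<bullet> y)\<bar> < \<bar>a \<bullet> p\<bar>"
      proof (cases "t = 0")
        case True then show ?thesis using False by simp
      next
        case False
        then have "\<bar>t * (a \<bullet> y)\<bar> < \<bar>t\<bar> * (\<bar>a \<bullet> y\<bar> + 1)" by (simp add: abs_mult)
        then show ?thesis using calculation by linarith
      qed
      ultimately have "\<bar>t * (a \<bullet> y)\<bar> < \<bar>a \<bullet> p\<bar>" by blast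
      then show ?thesis by (auto simp: inner_add_right sgn_if abs_if split: if_splits)
    qed
    moreover have "d > 0" unfolding d_def using False by (simp add: add_nonneg_pos)
    ultimately show ?thesis by blast
  qed
  then obtain d where d: "d > 0" "\<forall>t. \<bar>t\<bar> \<le> d \<longrightarrow> sgn (a \<bullet> (p + t *\<^sub>R y)) = sgn (a \<bullet> p)" by blast
  show ?case using e d by (intro exI[of _ "min d e"]) simp
qed

text \<open>The vector representing \<open>l\<close> lies in the span of \<open>B\<close>: its
  component orthogonal to \<open>B\<close> is in the kernel, hence orthogonal to the vector and so
  zero. The coefficients of an expansion in \<open>B\<close> then bound \<open>l\<close>.\<close>

lemma linear_functional_dominated:
  fixes l :: "'a::euclidean_space \<Rightarrow> real"
  assumes B: "finite B" and l: "linear l" and ker: "\<And>y. (\<forall>b\<in>B. b \<bullet> y = 0) \<Longrightarrow> l y = 0"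
  shows "\<exists>M\<ge>0. \<forall>y. l y \<le> M * (\<Sum>b\<in>B. \<bar>b \<bullet> y\<bar>)"
proof -
  define v where "v = adjoint l 1"
  have lv: "l y = v \<bullet> y" for y
    using adjoint_works[OF l, of y 1] unfolding v_def by (simp add: inner_commute)
  obtain p q where pq: "p \<in> span B" "\<And>w. w \<in> span B \<Longrightarrow> orthogonal q w" "v = p + q"
    using orthogonal_subspace_decomp_exists[of B v] by metis
  have "\<forall>b\<in>B. b \<bullet> q = 0" using pq(2) span_base unfolding orthogonal_def by (metis inner_commute)
  then have "v \<bullet> q = 0" using ker lv by metis
  moreover have "p \<bullet> q = 0" using pq(1,2) unfolding orthogonal_def by (metis inner_commute)
  ultimately have "q = 0" using pq(3) by (simp add: inner_add_left)
  then have "v \<in> span B" using pq by simp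
  then obtain c where c: "v = (\<Sum>b\<in>B. c b *\<^sub>R b)" unfolding span_finite[OF B] by blast
  define M where "M = (\<Sum>b\<in>B. \<bar>c b\<bar>)"
  have "l y \<le> M * (\<Sum>b\<in>B. \<bar>b \<bullet> y\<bar>)" for y
  proof -
    have "l y = (\<Sum>b\<in>B. c b * (b \<bullet> y))" unfolding lv c by (simp add: inner_sum_left)
    also have "\<dots> \<le> (\<Sum>b\<in>B. M * \<bar>b \<bullet> y\<bar>)"
    proof (rule sum_mono)
      fix b assume b: "b \<in> B"
      have "c b * (b \<bullet> y) \<le> \<bar>c b\<bar> * \<bar>b \<bullet> y\<bar>" by (metis abs_ge_self abs_mult)
      also have "\<dots> \<le> M * \<bar>b \<bullet> y\<bar>"
        unfolding M_def by (intro mult_right_mono member_le_sum) (use b B in auto)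
      finally show "c b * (b \<bullet> y) \<le> M * \<bar>b \<bullet> y\<bar>" .
    qed
    finally show ?thesis by (simp add: sum_distrib_left)
  qed
  moreover have "M \<ge> 0" unfolding M_def by (simp add: sum_nonneg)
  ultimately show ?thesis by blast
qed

text \<open>The support at \<open>x\<close> replaces each absolute value by its tangent there, with
  slope \<open>sgn (b \<bullet> \<iota> x)\<close>. If \<open>b\<close> vanishes at
  \<open>\<iota> x\<close> the slope is 0 and the full absolute value remains as slack, which
  absorbs the difference between the linear parts of \<open>g\<close> on two cells. The family
  \<open>G\<close> is a parameter so that \<open>g = 0\<close> can be treated with
  \<open>G = 0\<close>.\<close>

lemma concave_pa_minus_abs_sum:
  fixes g :: "'x::second_countable_topology \<Rightarrow> real" and \<iota> :: "'x \<Rightarrow> 'n::euclidean_space"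
  assumes C: "\<And>P. P \<in> C \<Longrightarrow> eucl_complex \<iota> P" and Q: "Q \<in> C"
    and sign: "\<And>\<rho> b. \<rho> \<in> Q \<Longrightarrow> b \<in> A \<Longrightarrow> (\<forall>z\<in>\<rho>. b \<bullet> \<iota> z \<le> 0) \<or> (\<forall>z\<in>\<rho>. b \<bullet> \<iota> z \<ge> 0)"
    and A: "finite A" and N: "N \<ge> 0"
    and G: "\<And>\<rho>. \<rho> \<in> Q \<Longrightarrow> \<rho> \<inter> U \<noteq> {} \<Longrightarrow> linear (G \<rho>)"
      "\<And>\<rho> x. \<rho> \<in> Q \<Longrightarrow> x \<in> \<rho> \<Longrightarrow> x \<in> U \<Longrightarrow> g x = G \<rho> (\<iota> x)"
    and bound: "\<And>x \<rho> \<theta> y. x \<in> U \<Longrightarrow> \<rho> \<in> Q \<Longrightarrow> \<theta> \<in> Q \<Longrightarrow> x \<in> \<rho> \<Longrightarrow> x \<in> \<theta> \<Longrightarrow>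
      G \<rho> y - G \<theta> y \<le> N * (\<Sum>b\<in>{b\<in>A. b \<bullet> \<iota> x = 0}. \<bar>b \<bullet> y\<bar>)"
  shows "pw_affine \<iota> Q U (\<lambda>z. g z - N * (\<Sum>b\<in>A. \<bar>b \<bullet> \<iota> z\<bar>))"
    and "concave_pa \<iota> C U (\<lambda>z. g z - N * (\<Sum>b\<in>A. \<bar>b \<bullet> \<iota> z\<bar>))"
proof -
  let ?F = "\<lambda>z. g z - N * (\<Sum>b\<in>A. \<bar>b \<bullet> \<iota> z\<bar>)"
  have lin: "linear (\<lambda>y. l y - N * (\<Sum>b\<in>A. s b * (b \<bullet> y)))" if "linear l" for l :: "'n \<Rightarrow> real" and s
  proof (intro linear_compose_sub that)
    have "linear (\<lambda>y. (N *\<^sub>R (\<Sum>b\<in>A. s b *\<^sub>R b)) \<bullet> y)"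
      by (rule bounded_linear.linear[OF bounded_linear_inner_right])
    then show "linear (\<lambda>y. N * (\<Sum>b\<in>A. s b * (b \<bullet> y)))" by (simp add: inner_sum_left)
  qed
  show pa: "pw_affine \<iota> Q U ?F"
    unfolding pw_affine_def
  proof (intro ballI impI)
    fix \<rho> assume \<rho>: "\<rho> \<in> Q" "\<rho> \<inter> U \<noteq> {}"
    \<comment> \<open>No functional of \<open>A\<close> changes sign on a cell, so there each
      absolute value is linear with a constant sign.\<close>
    define s where "s = (\<lambda>b. if \<forall>z\<in>\<rho>. b \<bullet> \<iota> z \<ge> 0 then 1 else - 1 :: real)"
    have s: "\<bar>b \<bullet> \<iota> z\<bar> = s b * (b \<bullet> \<iota> z)" if "b \<in> A" "z \<in> \<rho>" for b z
      using sign[OF \<rho>(1) that(1)] that(2) unfolding s_def by auto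
    have "\<forall>x\<in>\<rho> \<inter> U. ?F x = G \<rho> (\<iota> x) - N * (\<Sum>b\<in>A. s b * (b \<bullet> \<iota> x))"
      using G(2)[OF \<rho>(1)] s by simp
    then show "\<exists>l. linear l \<and> (\<forall>x\<in>\<rho> \<inter> U. ?F x = l (\<iota> x))"
      using lin[OF G(1)[OF \<rho>], of s] by (intro exI[of _ "\<lambda>y. G \<rho> y - N * (\<Sum>b\<in>A. s b * (b \<bullet> y))"] conjI)
  qed
  show "concave_pa \<iota> C U ?F"
  proof (rule concave_pa_if_local_support[OF C])
    show "\<exists>P\<in>C. pw_affine \<iota> P U ?F" using Q pa by blast
    fix x assume x: "x \<in> U"
    have cQ: "eucl_complex \<iota> Q" using C Q by blast
    obtain \<theta> where \<theta>: "\<theta> \<in> Q" "x \<in> \<theta>" using eucl_complex_cover[OF cQ] by blast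
    obtain W where W: "open W" "x \<in> W" "\<forall>\<eta>\<in>Q. \<eta> \<inter> W \<noteq> {} \<longrightarrow> x \<in> \<eta>"
      using eucl_complex_star[OF cQ, of x] by blast
    let ?s = "\<lambda>b. sgn (b \<bullet> \<iota> x)"
    let ?L = "\<lambda>y. G \<theta> y - N * (\<Sum>b\<in>A. ?s b * (b \<bullet> y))"
    have "linear (G \<theta>)" using G(1) \<theta> x by blast
    then have 1: "linear ?L" by (rule lin)
    have 2: "?F x = ?L (\<iota> x)" using G(2)[OF \<theta> x] by (simp add: abs_sgn mult.commute)
    have 3: "?F z \<le> ?L (\<iota> z)" if z: "z \<in> W \<inter> U" for z
    proof -
      obtain \<rho> where \<rho>: "\<rho> \<in> Q" "z \<in> \<rho>" using eucl_complex_cover[OF cQ] by blast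
      have "x \<in> \<rho>" using W(3) \<rho> z by blast
      then have b: "G \<rho> (\<iota> z) - G \<theta> (\<iota> z) \<le> N * (\<Sum>b\<in>{b\<in>A. b \<bullet> \<iota> x = 0}. \<bar>b \<bullet> \<iota> z\<bar>)"
        using bound[OF x \<rho>(1) \<theta>(1)] \<theta>(2) by blast
      have "(\<Sum>b\<in>{b\<in>A. b \<bullet> \<iota> x = 0}. \<bar>b \<bullet> \<iota> z\<bar>) = (\<Sum>b\<in>A. if b \<bullet> \<iota> x = 0 then \<bar>b \<bullet> \<iota> z\<bar> else 0)"
        using A by (simp add: sum.inter_filter)
      \<comment> \<open>Termwise: the gap between absolute value and tangent is never negative, and
        it is the whole absolute value when the sign at \<open>\<iota> x\<close> is 0.\<close>
      also have "\<dots> \<le> (\<Sum>b\<in>A. \<bar>b \<bullet> \<iota> z\<bar> - ?s b * (b \<bullet> \<iota> z))"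
        by (rule sum_mono) (auto simp: sgn_if)
      also have "\<dots> = (\<Sum>b\<in>A. \<bar>b \<bullet> \<iota> z\<bar>) - (\<Sum>b\<in>A. ?s b * (b \<bullet> \<iota> z))" by (rule sum_subtractf)
      finally have le: "(\<Sum>b\<in>{b\<in>A. b \<bullet> \<iota> x = 0}. \<bar>b \<bullet> \<iota> z\<bar>)
          \<le> (\<Sum>b\<in>A. \<bar>b \<bullet> \<iota> z\<bar>) - (\<Sum>b\<in>A. ?s b * (b \<bullet> \<iota> z))" .
      have "N * (\<Sum>b\<in>{b\<in>A. b \<bullet> \<iota> x = 0}. \<bar>b \<bullet> \<iota> z\<bar>)
          \<le> N * (\<Sum>b\<in>A. \<bar>b \<bullet> \<iota> z\<bar>) - N * (\<Sum>b\<in>A. ?s b * (b \<bullet> \<iota> z))"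
        using mult_left_mono[OF le N] by (simp add: right_diff_distrib)
      moreover have "g z = G \<rho> (\<iota> z)" using G(2)[OF \<rho>] z by blast
      ultimately show ?thesis using b by linarith
    qed
    show "\<exists>L W. linear L \<and> open W \<and> x \<in> W \<and> ?F x = L (\<iota> x) \<and> (\<forall>z\<in>W \<inter> U. ?F z \<le> L (\<iota> z))"
      using 1 2 3 W(1,2) by (intro exI[of _ ?L] exI[of _ W] conjI ballI)
  qed
qed

section \<open>Difference of concave functions\<close>

lemma structure_class_subdivision:
  assumes "eucl_complex \<iota> P" "eucl_complex \<iota> Q" "subdivides Q P"
  shows "Q \<in> structure_class \<iota> P"
proof -
  have "common_subdiv \<iota> P Q"
    unfolding common_subdiv_def using assms subdivides_refl by blast
  then show ?thesis unfolding structure_class_def using assms(2) by blast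
qed

theorem theorem4p23:
  fixes \<iota> :: "'x::second_countable_topology \<Rightarrow> 'n::euclidean_space"
    and U :: "'x set" and Pc :: "'x set set"
  assumes hyperplane: "\<exists>a. \<forall>x. a \<bullet> \<iota> x = 1"
    and complex: "eucl_complex \<iota> Pc"
    and U_open: "open U"
    and fin: "finite {\<sigma>\<in>Pc. \<sigma> \<inter> U \<noteq> {}}"
  shows "\<exists>Pc'. eucl_complex \<iota> Pc' \<and> subdivides Pc' Pc \<and>
           (\<forall>g. pw_affine \<iota> Pc' U g \<longrightarrow>
              (\<exists>f1 f2. pw_affine \<iota> Pc' U f1 \<and> pw_affine \<iota> Pc' U f2 \<and>
                 concave_pa \<iota> (structure_class \<iota> Pc) U f1 \<and>
                 concave_pa \<iota> (structure_class \<iota> Pc) U f2 \<and>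
                 (\<forall>x\<in>U. g x = f1 x - f2 x)))"
proof -
  let ?C = "structure_class \<iota> Pc"
  obtain e where e: "\<And>x. e \<bullet> \<iota> x = 1" using hyperplane by blast
  let ?S = "{\<sigma>\<in>Pc. \<sigma> \<inter> U \<noteq> {}}"
  have "\<forall>\<sigma>\<in>Pc. \<exists>A. finite A \<and> \<iota> ` \<sigma> = {y. e \<bullet> y = 1 \<and> (\<forall>b\<in>A. b \<bullet> y \<le> 0)}"
  proof
    fix \<sigma> assume "\<sigma> \<in> Pc"
    then show "\<exists>A. finite A \<and> \<iota> ` \<sigma> = {y. e \<bullet> y = 1 \<and> (\<forall>b\<in>A. b \<bullet> y \<le> 0)}"
      using e by (intro polyhedron_in_hyperplane eucl_complexD(3)[OF complex]) auto
  qed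
  from bchoice[OF this] obtain B
    where "\<forall>\<sigma>\<in>Pc. finite (B \<sigma>) \<and> \<iota> ` \<sigma> = {y. e \<bullet> y = 1 \<and> (\<forall>b\<in>B \<sigma>. b \<bullet> y \<le> 0)}" by (rule exE)
  then have B: "finite (B \<sigma>)" "\<iota> ` \<sigma> = {y. e \<bullet> y = 1 \<and> (\<forall>b\<in>B \<sigma>. b \<bullet> y \<le> 0)}" if "\<sigma> \<in> Pc" for \<sigma>
    using that by simp_all
  \<comment> \<open>Only cells meeting \<open>U\<close> contribute, which keeps \<open>A\<close>
    finite; the arguments below stay at points of \<open>U\<close>.\<close>
  define A where "A = (\<Union>\<sigma>\<in>?S. B \<sigma>)"
  have A: "finite A" unfolding A_def using fin B(1) by blast
  obtain Q where Q: "eucl_complex \<iota> Q" "subdivides Q Pc" "finite {\<rho>\<in>Q. \<rho> \<inter> U \<noteq> {}}"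
    "\<forall>\<rho>\<in>Q. \<forall>b\<in>A. (\<forall>z\<in>\<rho>. b \<bullet> \<iota> z \<le> 0) \<or> (\<forall>z\<in>\<rho>. b \<bullet> \<iota> z \<ge> 0)"
    "\<forall>\<rho>\<in>Q. \<exists>\<sigma>\<in>Pc. \<rho> \<subseteq> \<sigma> \<and>
       (\<forall>x\<in>\<rho>. \<forall>w\<in>\<sigma>. (\<forall>b\<in>A. sgn (b \<bullet> \<iota> w) = sgn (b \<bullet> \<iota> x)) \<longrightarrow> w \<in> \<rho>)"
    using exists_arrangement_subdivision[OF complex fin A] by (elim exE conjE) (rule that)
  have QC: "Q \<in> ?C" using structure_class_subdivision[OF complex Q(1,2)] .
  have C: "eucl_complex \<iota> P" if "P \<in> ?C" for P using that unfolding structure_class_def by blast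
  have sign: "(\<forall>z\<in>\<rho>. b \<bullet> \<iota> z \<le> 0) \<or> (\<forall>z\<in>\<rho>. b \<bullet> \<iota> z \<ge> 0)" if "\<rho> \<in> Q" "b \<in> A" for \<rho> b
    using bspec[OF bspec[OF Q(4) that(1)] that(2)] .
  have decompose: "\<exists>f1 f2. pw_affine \<iota> Q U f1 \<and> pw_affine \<iota> Q U f2 \<and> concave_pa \<iota> ?C U f1 \<and>
      concave_pa \<iota> ?C U f2 \<and> (\<forall>x\<in>U. g x = f1 x - f2 x)" if g: "pw_affine \<iota> Q U g" for g
  proof -
    have "\<forall>\<rho>\<in>{\<rho>\<in>Q. \<rho> \<inter> U \<noteq> {}}. \<exists>l. linear l \<and> (\<forall>x\<in>\<rho> \<inter> U. g x = l (\<iota> x))"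
      using g unfolding pw_affine_def by simp
    from bchoice[OF this] obtain G
      where G: "\<forall>\<rho>\<in>{\<rho>\<in>Q. \<rho> \<inter> U \<noteq> {}}. linear (G \<rho>) \<and> (\<forall>x\<in>\<rho> \<inter> U. g x = G \<rho> (\<iota> x))" by (rule exE)
    have linG: "linear (G \<rho>)" if "\<rho> \<in> Q" "\<rho> \<inter> U \<noteq> {}" for \<rho> using G that by blast
    have gG: "g x = G \<rho> (\<iota> x)" if "\<rho> \<in> Q" "x \<in> \<rho>" "x \<in> U" for \<rho> x using G that by blast
    \<comment> \<open>The functionals vanishing at \<open>\<iota> x\<close> cut out only directions
      that can be realised inside \<open>\<rho> \<inter> \<theta> \<inter> U\<close>, up to
      multiples of \<open>\<iota> x\<close> itself.\<close>
    have agree: "G \<rho> y = G \<theta> y"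
      if x: "x \<in> U" "x \<in> \<rho>" "x \<in> \<theta>" and \<rho>: "\<rho> \<in> Q" and \<theta>: "\<theta> \<in> Q"
        and y: "\<forall>b\<in>A. b \<bullet> \<iota> x = 0 \<longrightarrow> b \<bullet> y = 0" for x \<rho> \<theta> y
    proof -
      have lin: "linear (G \<rho>)" "linear (G \<theta>)" using linG[OF \<rho>] linG[OF \<theta>] x by blast+
      \<comment> \<open>Subtracting a multiple of \<open>\<iota> x\<close> makes the move parallel
        to the hyperplane. Nothing is lost: both linear parts take the value \<open>g x\<close> at
        \<open>\<iota> x\<close>.\<close>
      define y1 where "y1 = y - (e \<bullet> y) *\<^sub>R \<iota> x"
      have ey1: "e \<bullet> y1 = 0" unfolding y1_def using e by (simp add: inner_diff_right)
      have by1: "\<forall>b\<in>A. b \<bullet> \<iota> x = 0 \<longrightarrow> b \<bullet> y1 = 0" unfolding y1_def using y by (simp add: inner_diff_right)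
      \<comment> \<open>The intersection is itself a cell of \<open>Q\<close>, so preserving signs
        keeps a point in both cells at once.\<close>
      have \<eta>: "\<rho> \<inter> \<theta> \<in> Q" using eucl_complexD(5,6)[OF Q(1) \<rho>] \<theta> by blast
      obtain \<sigma> where \<sigma>: "\<sigma> \<in> Pc" "\<rho> \<inter> \<theta> \<subseteq> \<sigma>"
        "\<forall>x\<in>\<rho> \<inter> \<theta>. \<forall>w\<in>\<sigma>. (\<forall>b\<in>A. sgn (b \<bullet> \<iota> w) = sgn (b \<bullet> \<iota> x)) \<longrightarrow> w \<in> \<rho> \<inter> \<theta>"
        using bspec[OF Q(5) \<eta>] by (elim bexE conjE) (rule that)
      have x\<sigma>: "x \<in> \<sigma>" using \<sigma>(2) x by blast
      then have B\<sigma>: "B \<sigma> \<subseteq> A" unfolding A_def using \<sigma>(1) x(1) by blast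
      obtain d where d: "d > 0" "\<forall>t. \<bar>t\<bar> \<le> d \<longrightarrow> (\<forall>b\<in>A. sgn (b \<bullet> (\<iota> x + t *\<^sub>R y1)) = sgn (b \<bullet> \<iota> x))"
        using sgn_inner_stable[OF A by1] by blast
      obtain r where r: "r > 0" "\<forall>z\<in>\<sigma>. dist (\<iota> z) (\<iota> x) < r \<longrightarrow> z \<in> U"
        using eucl_complex_near[OF complex \<sigma>(1) x\<sigma> x(1) U_open] by blast
      define t where "t = min d (r / (norm y1 + 1))"
      have t: "t > 0" "\<bar>t\<bar> \<le> d" "t \<le> r / (norm y1 + 1)"
        using d(1) r(1) unfolding t_def by (auto simp: add_nonneg_pos)
      let ?p = "\<iota> x + t *\<^sub>R y1"
      have sg: "\<forall>b\<in>A. sgn (b \<bullet> ?p) = sgn (b \<bullet> \<iota> x)" using d(2) t(2) by blast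
      \<comment> \<open>As \<open>\<sigma>\<close> meets \<open>U\<close>, its own inequalities are
        in \<open>A\<close> and hold at \<open>?p\<close> with the signs they have at
        \<open>\<iota> x\<close>. This provides a point of X over \<open>?p\<close>.\<close>
      have "b \<bullet> ?p \<le> 0" if "b \<in> B \<sigma>" for b
      proof -
        have "\<iota> x \<in> {y. e \<bullet> y = 1 \<and> (\<forall>b\<in>B \<sigma>. b \<bullet> y \<le> 0)}" using B(2)[OF \<sigma>(1)] x\<sigma> by blast
        then have "b \<bullet> \<iota> x \<le> 0" using that by blast
        moreover have "sgn (b \<bullet> ?p) = sgn (b \<bullet> \<iota> x)" using sg that B\<sigma> by blast
        ultimately show ?thesis by (metis linorder_not_le sgn_greater)
      qed
      moreover have "e \<bullet> ?p = 1" using e ey1 by (simp add: inner_add_right)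
      ultimately have "?p \<in> \<iota> ` \<sigma>" unfolding B(2)[OF \<sigma>(1)] by blast
      then obtain w where w: "w \<in> \<sigma>" "\<iota> w = ?p" by (metis imageE)
      have "\<forall>b\<in>A. sgn (b \<bullet> \<iota> w) = sgn (b \<bullet> \<iota> x)" unfolding w(2) by (rule sg)
      then have w\<eta>: "w \<in> \<rho> \<inter> \<theta>" by (rule mp[OF bspec[OF bspec[OF \<sigma>(3) IntI[OF x(2,3)]] w(1)]])
      have "t * norm y1 < r"
      proof -
        have "t * (norm y1 + 1) \<le> r" using t(3) by (simp add: pos_le_divide_eq add_nonneg_pos)
        then show ?thesis using t(1) by (simp add: distrib_left)
      qed
      then have "dist (\<iota> w) (\<iota> x) < r" unfolding w(2) using t(1) by (simp add: dist_norm)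
      then have wU: "w \<in> U" using r(2) w(1) by blast
      have gx: "G \<rho> (\<iota> x) = G \<theta> (\<iota> x)" using gG[OF \<rho> x(2,1)] gG[OF \<theta> x(3,1)] by simp
      have "G \<rho> ?p = G \<theta> ?p" 
        unfolding w(2)[symmetric] using gG[OF \<rho> IntD1[OF w\<eta>] wU] gG[OF \<theta> IntD2[OF w\<eta>] wU] by simp
      then have "t * G \<rho> y1 = t * G \<theta> y1" using gx lin by (simp add: linear_add linear_scale)
      then have "G \<rho> y1 = G \<theta> y1" using t(1) by simp
      moreover have "y = y1 + (e \<bullet> y) *\<^sub>R \<iota> x" unfolding y1_def by simp
      then have "G \<kappa> y = G \<kappa> y1 + (e \<bullet> y) * G \<kappa> (\<iota> x)" if "linear (G \<kappa>)" for \<kappa>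
        using linear_add[OF that, of y1 "(e \<bullet> y) *\<^sub>R \<iota> x"] linear_scale[OF that] by simp
      ultimately show ?thesis using gx lin by simp
    qed
    let ?T = "{\<rho>\<in>Q. \<rho> \<inter> U \<noteq> {}}"
    let ?I = "?T \<times> ?T \<times> Pow A"
    have finI: "finite ?I" using Q(3) A by blast
    \<comment> \<open>The set \<open>D\<close> takes the place of the point \<open>x\<close>, so
      that constants are needed for a finite index set only. Triples that admit no constant receive
      an arbitrary nonnegative \<open>m i\<close>.\<close>
    define good where "good = (\<lambda>(\<rho>, \<theta>, D) M. \<forall>y. G \<rho> y - G \<theta> y \<le> M * (\<Sum>b\<in>D. \<bar>b \<bullet> y\<bar>))"
    have "\<exists>M\<ge>0. (\<exists>M\<ge>0. good i M) \<longrightarrow> good i M" for i by (cases "\<exists>M\<ge>0. good i M") auto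
    then have "\<exists>m. \<forall>i. m i \<ge> 0 \<and> ((\<exists>M\<ge>0. good i M) \<longrightarrow> good i (m i))" by (intro choice allI)
    then obtain m where "\<forall>i. m i \<ge> 0 \<and> ((\<exists>M\<ge>0. good i M) \<longrightarrow> good i (m i))" by (rule exE)
    then have m: "m i \<ge> 0" "\<exists>M\<ge>0. good i M \<Longrightarrow> good i (m i)" for i by blast+
    define N where "N = sum m ?I"
    have N: "N \<ge> 0" unfolding N_def using m(1) by (simp add: sum_nonneg)
    have bound: "G \<rho> y - G \<theta> y \<le> N * (\<Sum>b\<in>{b\<in>A. b \<bullet> \<iota> x = 0}. \<bar>b \<bullet> y\<bar>)"
      if x: "x \<in> U" and \<rho>: "\<rho> \<in> Q" and \<theta>: "\<theta> \<in> Q" and x\<rho>: "x \<in> \<rho>" and x\<theta>: "x \<in> \<theta>" for x \<rho> \<theta> y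
    proof -
      let ?D = "{b\<in>A. b \<bullet> \<iota> x = 0}"
      let ?i = "(\<rho>, \<theta>, ?D)"
      have lin: "linear (\<lambda>y. G \<rho> y - G \<theta> y)"
        using linG[OF \<rho>] linG[OF \<theta>] x x\<rho> x\<theta> by (intro linear_compose_sub) blast+
      have fD: "finite ?D" using A by simp
      have ker: "G \<rho> y - G \<theta> y = 0" if "\<forall>b\<in>?D. b \<bullet> y = 0" for y
        using agree[OF x x\<rho> x\<theta> \<rho> \<theta>, of y] that by simp
      have "\<exists>M\<ge>0. good ?i M"
        using linear_functional_dominated[OF fD lin ker] unfolding good_def by simp
      then have "good ?i (m ?i)" by (rule m(2))
      then have "G \<rho> y - G \<theta> y \<le> m ?i * (\<Sum>b\<in>?D. \<bar>b \<bullet> y\<bar>)" unfolding good_def by simp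
      also have "\<dots> \<le> N * (\<Sum>b\<in>?D. \<bar>b \<bullet> y\<bar>)"
      proof (rule mult_right_mono)
        have "?i \<in> ?I" using \<rho> \<theta> x x\<rho> x\<theta> by blast
        then show "m ?i \<le> N" unfolding N_def using finI m(1) by (intro member_le_sum)
      qed (simp add: sum_nonneg)
      finally show ?thesis .
    qed
    let ?h = "\<lambda>z. \<Sum>b\<in>A. \<bar>b \<bullet> \<iota> z\<bar>"
    have zero: "linear (\<lambda>_. 0 :: real)" by (simp add: linear_iff)
    have "pw_affine \<iota> Q U (\<lambda>z. g z - N * ?h z)"
      by (rule concave_pa_minus_abs_sum(1)[OF C QC sign A N linG gG bound])
    moreover have "concave_pa \<iota> ?C U (\<lambda>z. g z - N * ?h z)"
      by (rule concave_pa_minus_abs_sum(2)[OF C QC sign A N linG gG bound])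
    \<comment> \<open>The second function is the case \<open>g = 0\<close>, whose linear parts are
      all zero and satisfy the bound trivially.\<close>
    moreover have "pw_affine \<iota> Q U (\<lambda>z. 0 - N * ?h z)"
      by (rule concave_pa_minus_abs_sum(1)[where g = "\<lambda>_. 0" and G = "\<lambda>_ _. 0", OF C QC sign A N zero])
        (simp_all add: N sum_nonneg)
    moreover have "concave_pa \<iota> ?C U (\<lambda>z. 0 - N * ?h z)"
      by (rule concave_pa_minus_abs_sum(2)[where g = "\<lambda>_. 0" and G = "\<lambda>_ _. 0", OF C QC sign A N zero])
        (simp_all add: N sum_nonneg)
    moreover have "\<forall>x\<in>U. g x = (g x - N * ?h x) - (0 - N * ?h x)" by simp
    ultimately show ?thesis
      by (intro exI[of _ "\<lambda>z. g z - N * ?h z"] exI[of _ "\<lambda>z. 0 - N * ?h z"] conjI)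
  qed
  then show ?thesis using Q(1,2) by blast
qed

end
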